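(* Let $d\ge1$ and let $\mathbf{r}=(r_0,\ldots,r_{d-1})\in\mathbb{R}^d$ with $r_0\ne0$ be such that the companion matrix $M_\mathbf{r}$ has spectral radius strictly less than $1$. Assume that at least one of the following holds: $\mathbf{r}\in\mathbb{Q}^d$; or there is a Pisot number $\beta$ with minimal polynomial $(x-\beta)(x^d+r_{d-1}x^{d-1}+\cdots+r_1x+r_0)$; or $r_0,\ldots,r_{d-1}$ are algebraically independent over $\mathbb{Q}$. Then: (1) The collection of SRS tiles $\{\mathcal{T}_\mathbf{r}(\mathbf{x})\mid\mathbf{x}\in\mathbb{Z}^d\}$ is a weak $m$-tiling of $\mathbb{R}^d$ for some positive integer $m$. (2) If $(\mathbb{Z}^d,\tau_\mathbf{r})$ satisfies the finiteness property, then $\{\mathcal{T}_\mathbf{r}(\mathbf{x})\mid\mathbf{x}\in\mathbb{Z}^d\}$ is a weak tiling of $\mathbb{R}^d$.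
   Context: For $\mathbf{r}=(r_0,\ldots,r_{d-1})\in\mathbb{R}^d$ and $\mathbf{z}=(z_0,\ldots,z_{d-1})^t\in\mathbb{Z}^d$ put $\mathbf{r}\mathbf{z}=\sum_i r_iz_i$ and $\tau_\mathbf{r}(\mathbf{z})=(z_1,\ldots,z_{d-1},-\lfloor\mathbf{r}\mathbf{z}\rfloor)^t$, a map $\mathbb{Z}^d\to\mathbb{Z}^d$; $\tau_\mathbf{r}^{-n}(\mathbf{x})=\{\mathbf{z}\in\mathbb{Z}^d\mid\tau_\mathbf{r}^n(\mathbf{z})=\mathbf{x}\}$. $(\mathbb{Z}^d,\tau_\mathbf{r})$ satisfies the finiteness property if for every $\mathbf{z}\in\mathbb{Z}^d$ there is $n\in\mathbb{N}$ with $\tau_\mathbf{r}^n(\mathbf{z})=\mathbf{0}$. The companion matrix $M_\mathbf{r}\in\mathbb{R}^{d\times d}$ has last row $(-r_0,\ldots,-r_{d-1})$, entries $1$ on the superdiagonal of the first $d-1$ rows, and $0$ elsewhere (for $d=1$, $M_\mathbf{r}=(-r_0)$). The SRS tile of $\mathbf{x}\in\mathbb{Z}^d$ is $\mathcal{T}_\mathbf{r}(\mathbf{x})=\mathrm{Li}_{n\to\infty}M_\mathbf{r}^n\tau_\mathbf{r}^{-n}(\mathbf{x})$, where the lower Hausdorff limit $\mathrm{Li}_{n\to\infty}A_n$ is the set of all $\mathbf{t}\in\mathbb{R}^d$ such that each neighbourhood of $\mathbf{t}$ intersects $A_n$ for all sufficiently large $n$. A Pisot number is an algebraic integer $\beta>1$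 all of whose other Galois conjugates have modulus $<1$. Let $\mathcal{K}=(K_i)_{i\in I}$ be a locally finite family of compact sets covering $\mathbb{R}^d$ (locally finite: every open ball meets only finitely many members); SRS tiles form such a family, indexed by $\mathbf{x}\in\mathbb{Z}^d$. The covering degree of a point is $\deg(\mathcal{K},\mathbf{t})=\#\{i\in I\mid\mathbf{t}\in K_i\}$ and $\deg(\mathcal{K})=\min_{\mathbf{t}\in\mathbb{R}^d}\deg(\mathcal{K},\mathbf{t})$. $\mathcal{K}$ is a weak $m$-tiling if $\deg(\mathcal{K})=m$ and $\bigcap_{k=1}^{m+1}\mathrm{int}(K_{i_k})=\emptyset$ for all pairwise different $i_1,\ldots,i_{m+1}\in I$. A weak tiling is a weak $1$-tiling. *)

theory Defs
  imports
    "HOL-Analysis.Analysis"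
    "HOL-Library.Poly_Mapping"
    "HOL-Computational_Algebra.Polynomial_Factorial"
    "Jordan_Normal_Form.Spectral_Radius"
begin

no_notation Matrix.vec_index (infixl "$" 100)

text \<open>
  Vectors of dimension \<open>d = CARD('n)\<close> are indexed by a finite linearly ordered type \<open>'n\<close>. The
  coordinate indices \<open>0, \<dots>, d - 1\<close> correspond to the elements of \<open>'n\<close> in increasing order:
  \<open>ix k\<close> is the element with index \<open>k\<close>, and \<open>pos i\<close> is the index of the element \<open>i\<close>. Hence the
  \<open>k\<close>-th coordinate of \<open>v\<close> is \<open>v $ ix k\<close>.
\<close>

definition pos :: "'n::{finite,linorder} \<Rightarrow> nat" where
  "pos i = card {j. j < i}"

definition ix :: "nat \<Rightarrow> 'n::{finite,linorder}" where
  "ix k = sorted_list_of_set UNIV ! k"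

lemma strict_mono_ix:
  assumes "k < l" "l < CARD('n::{finite,linorder})"
  shows "(ix k :: 'n) < ix l"
  using assms unfolding ix_def
  by (metis finite_class.finite_UNIV length_sorted_list_of_set sorted_wrt_nth_less
      strict_sorted_list_of_set)

lemma pos_ix:
  assumes "k < CARD('n::{finite,linorder})"
  shows "pos (ix k :: 'n) = k"
proof -
  let ?xs = "sorted_list_of_set (UNIV :: 'n set)"
  have "{j. j < (ix k :: 'n)} = ix ` {..<k}"
  proof (intro equalityI subsetI)
    fix j :: 'n assume "j \<in> {j. j < ix k}"
    hence j: "j < ix k" by simp
    have "j \<in> set ?xs" by simp
    then obtain l where l: "l < CARD('n)" "j = ix l"
      unfolding ix_def in_set_conv_nth by auto
    have "l < k"
      using j l strict_mono_ix[of k l, where ?'n = 'n] by (metis less_asym nat_neq_iff less_irrefl)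
    thus "j \<in> ix ` {..<k}" using l by auto
  qed (use assms strict_mono_ix in auto)
  moreover have "inj_on (ix :: nat \<Rightarrow> 'n) {..<k}"
    by (rule linorder_inj_onI) (use assms strict_mono_ix[where ?'n = 'n] in \<open>fastforce+\<close>)
  ultimately show ?thesis by (simp add: pos_def card_image)
qed

lemma ix_pos: "pos i < CARD('n)" "ix (pos i) = i" for i :: "'n::{finite,linorder}"
proof -
  have "i \<in> set (sorted_list_of_set (UNIV :: 'n set))" by simp
  then obtain l where "l < CARD('n)" "i = ix l"
    unfolding ix_def in_set_conv_nth by auto
  thus "pos i < CARD('n)" "ix (pos i) = i" using pos_ix[of l, where ?'n = 'n] by auto
qed

definition real_vec :: "int ^ 'n \<Rightarrow> real ^ 'n" where
  "real_vec z = (\<chi> i. real_of_int (z $ i))"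

definition srs_map ::
  "real ^ 'n::{finite,linorder} \<Rightarrow> int ^ 'n::{finite,linorder} \<Rightarrow> int ^ 'n::{finite,linorder}" where
  "srs_map r z =
     (\<chi> i. if Suc (pos i) < CARD('n) then z $ ix (Suc (pos i))
          else - \<lfloor>\<Sum>j\<in>UNIV. r $ j * real_of_int (z $ j)\<rfloor>)"

definition finiteness_property :: "real ^ 'n::{finite,linorder} \<Rightarrow> bool" where
  "finiteness_property r \<longleftrightarrow> (\<forall>z. \<exists>n. (srs_map r ^^ n) z = 0)"

definition companion ::
  "real ^ 'n::{finite,linorder} \<Rightarrow> real ^ 'n::{finite,linorder} ^ 'n::{finite,linorder}" where
  "companion r =
     (\<chi> i j. if Suc (pos i) = CARD('n) then - (r $ j)
            else if pos j = Suc (pos i) then 1 else 0)"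

definition complex_mat :: "real ^ 'n::{finite,linorder} ^ 'n::{finite,linorder} \<Rightarrow> complex mat" where
  "complex_mat A = Matrix.mat CARD('n) CARD('n) (\<lambda>(k, l). complex_of_real (A $ ix k $ ix l))"

definition lower_limit :: "(nat \<Rightarrow> 'a::topological_space set) \<Rightarrow> 'a set" where
  "lower_limit A = {t. \<forall>U. open U \<and> t \<in> U \<longrightarrow> (\<forall>\<^sub>F n in sequentially. U \<inter> A n \<noteq> {})}"

definition srs_tile ::
  "real ^ 'n::{finite,linorder} \<Rightarrow> int ^ 'n::{finite,linorder} \<Rightarrow> (real ^ 'n::{finite,linorder}) set" where
  "srs_tile r x =
     lower_limit (\<lambda>n. (\<lambda>z. ((*v) (companion r) ^^ n) (real_vec z)) ` {z. (srs_map r ^^ n) z = x})"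

definition is_min_poly :: "rat poly \<Rightarrow> real \<Rightarrow> bool" where
  "is_min_poly p x \<longleftrightarrow>
     lead_coeff p = 1 \<and> Factorial_Ring.irreducible p \<and> poly (map_poly of_rat p) x = 0"

definition pisot :: "real \<Rightarrow> bool" where
  "pisot \<beta> \<longleftrightarrow> algebraic_int \<beta> \<and> \<beta> > 1 \<and>
     (\<forall>p (z::complex). is_min_poly p \<beta> \<and> poly (map_poly of_rat p) z = 0 \<and> z \<noteq> of_real \<beta>
        \<longrightarrow> cmod z < 1)"

text \<open>
  Polynomials in the variables \<open>'i\<close> are finitely supported maps from exponent vectors to
  coefficients.
\<close>

definition alg_independent_over_rat :: "('i::finite \<Rightarrow> real) \<Rightarrow> bool" where
  "alg_independent_over_rat x \<longleftrightarrow>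
     (\<forall>p :: ('i \<Rightarrow>\<^sub>0 nat) \<Rightarrow>\<^sub>0 rat.
        (\<Sum>m\<in>Poly_Mapping.keys p.
            of_rat (Poly_Mapping.lookup p m) * (\<Prod>i\<in>UNIV. x i ^ Poly_Mapping.lookup m i)) = 0
        \<longrightarrow> p = 0)"

definition compact_locally_finite_cover :: "('i \<Rightarrow> 'a::metric_space set) \<Rightarrow> bool" where
  "compact_locally_finite_cover K \<longleftrightarrow>
     (\<forall>i. compact (K i)) \<and> (\<forall>c e. finite {i. ball c e \<inter> K i \<noteq> {}}) \<and> (\<Union>i. K i) = UNIV"

definition covering_degree_at :: "('i \<Rightarrow> 'a set) \<Rightarrow> 'a \<Rightarrow> nat" where
  "covering_degree_at K t = card {i. t \<in> K i}"

text \<open>The infimum of a nonempty set of natural numbers is its minimum.\<close>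

definition covering_degree :: "('i \<Rightarrow> 'a set) \<Rightarrow> nat" where
  "covering_degree K = (INF t. covering_degree_at K t)"

definition weak_m_tiling :: "nat \<Rightarrow> ('i \<Rightarrow> 'a::metric_space set) \<Rightarrow> bool" where
  "weak_m_tiling m K \<longleftrightarrow>
     compact_locally_finite_cover K \<and> covering_degree K = m \<and>
     (\<forall>J. finite J \<and> card J = m + 1 \<longrightarrow> (\<Inter>i\<in>J. interior (K i)) = {})"

definition weak_tiling :: "('i \<Rightarrow> 'a::metric_space set) \<Rightarrow> bool" where
  "weak_tiling K \<longleftrightarrow> weak_m_tiling 1 K"

end

(*
  Write M for the companion matrix and tau for the SRS map. Up to a bounded error tau is M, so
  tau^n stays within R of M^n, where R is a geometric sum, and the tile of x is within a distance of
  order rho^n of M^n tau^(-n)(x). This gives compactness, local finiteness and the covering property,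
  and M^(-n) T(x) is the union of the tiles T(y) with tau^n(y) = x.

  If more than m = covering degree tiles had a common interior point, then applying M^(-n) would produce
  arbitrarily large balls all of whose points are covered more than m times. This is impossible as soon
  as the points of degree at most m are relatively dense, and for this it is enough that, for all n and
  delta > 0, the z in Z^d for which the fractional parts of r . tau^k(z), k < n, are below delta are
  relatively dense. If r is rational with denominator q, take z in q^n Z^d. If r comes from a Pisot
  number beta, then r . tau(z) = beta {r . z} mod 1, and a one-dimensional approximation suffices. If r is
  algebraically independent, use Kronecker's theorem for the numbers r . M^k e, with e the last
  unit vector.

  Under the finiteness property 0 lies only in the tile of 0: a tile containing 0 has tau^n-preimages y
  with 0 in T(y) for all n, and there are only finitely many such y.
*)

theory Submission
  imports Defs "HOL-Computational_Algebra.Field_as_Ring"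
begin

no_notation Matrix.scalar_prod (infix "\<bullet>" 70)


section \<open>Powers of the companion matrix\<close>

lemma bij_betw_ix: "bij_betw (ix :: nat \<Rightarrow> 'n) {..<CARD('n)} (UNIV :: 'n::{finite,linorder} set)"
  by (rule bij_betw_byWitness[of _ pos]) (auto simp: pos_ix ix_pos)

lemma sum_UNIV_ix:
  "(\<Sum>i\<in>UNIV. f i) = (\<Sum>k<CARD('n). f (ix k))" for f :: "'n::{finite,linorder} \<Rightarrow> 'a::comm_monoid_add"
  by (rule sum.reindex_bij_betw[OF bij_betw_ix, symmetric])

definition complex_vec :: "real ^ 'n::{finite,linorder} \<Rightarrow> complex vec" where
  "complex_vec v = Matrix.vec CARD('n) (\<lambda>k. complex_of_real (v $ ix k))"

lemma complex_mat_carrier [simp]: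
  "complex_mat (A :: real ^ 'n::{finite,linorder} ^ 'n::{finite,linorder}) \<in> carrier_mat CARD('n) CARD('n)"
  by (simp add: complex_mat_def)

lemma complex_vec_carrier [simp]:
  "complex_vec (v :: real ^ 'n::{finite,linorder}) \<in> carrier_vec CARD('n)"
  by (simp add: complex_vec_def)

lemma complex_mat_mult_vec:
  "complex_mat A *\<^sub>v complex_vec v = complex_vec (A *v v)"
  for A :: "real ^ 'n::{finite,linorder} ^ 'n::{finite,linorder}"
  by (rule eq_vecI)
    (auto simp: complex_mat_def complex_vec_def matrix_vector_mult_def scalar_prod_def sum_UNIV_ix atLeast0LessThan)

lemma complex_mat_pow_mult_vec:
  "complex_mat A ^\<^sub>m k *\<^sub>v complex_vec v = complex_vec (((*v) A ^^ k) v)"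
  for A :: "real ^ 'n::{finite,linorder} ^ 'n::{finite,linorder}"
proof (induction k arbitrary: v)
  case 0
  have "dim_row (complex_mat A) = CARD('n)" by (simp add: complex_mat_def)
  then show ?case using one_mult_mat_vec[OF complex_vec_carrier[of v]] by simp
next
  case (Suc k)
  have "complex_mat A ^\<^sub>m Suc k *\<^sub>v complex_vec v
      = complex_mat A ^\<^sub>m k *\<^sub>v (complex_mat A *\<^sub>v complex_vec v)"
    using assoc_mult_mat_vec[of "complex_mat A ^\<^sub>m k" "CARD('n)" "CARD('n)" "complex_mat A"
        "CARD('n)" "complex_vec v"] by (simp add: pow_carrier_mat)
  then show ?case by (simp add: complex_mat_mult_vec Suc.IH funpow_swap1)
qed

lemma smult_pow_mat:
  fixes A :: "complex mat"
  assumes "A \<in> carrier_mat n n"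
  shows "(c \<cdot>\<^sub>m A) ^\<^sub>m k = c ^ k \<cdot>\<^sub>m (A ^\<^sub>m k)"
proof (induction k)
  case 0
  then show ?case using assms by auto
next
  case (Suc k)
  have "(c ^ k \<cdot>\<^sub>m (A ^\<^sub>m k)) * (c \<cdot>\<^sub>m A) = c ^ k \<cdot>\<^sub>m (A ^\<^sub>m k * (c \<cdot>\<^sub>m A))"
    using assms by (intro mult_smult_assoc_mat) auto
  also have "A ^\<^sub>m k * (c \<cdot>\<^sub>m A) = c \<cdot>\<^sub>m (A ^\<^sub>m k * A)"
    using assms by (intro mult_smult_distrib) auto
  finally show ?case using Suc by (auto simp: mult_ac intro!: eq_matI)
qed

text \<open>Divide \<open>A\<close> by the midpoint \<open>s\<close> between its spectral radius and
  1. The quotient still has spectral radius below 1, so its powers are bounded by the Jordan form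
  estimate, and those of \<open>A\<close> decay like \<open>s ^ k\<close>.\<close>

lemma spectral_radius_less_1_pow_bound:
  fixes A :: "complex mat"
  assumes A: "A \<in> carrier_mat n n" and n: "n > 0" and sr: "spectral_radius A < 1"
  shows "\<exists>c \<rho>. 0 < \<rho> \<and> \<rho> < 1 \<and> (\<forall>k. norm_bound (A ^\<^sub>m k) (c * \<rho> ^ k))"
proof -
  define s where "s = (spectral_radius A + 1) / 2"
  have "spectral_radius A \<ge> 0"
    using spectral_radius_mem_max(1)[OF A n] by auto
  with sr have s: "0 < s" "s < 1" "spectral_radius A < s" by (auto simp: s_def)
  define B where "B = complex_of_real (1 / s) \<cdot>\<^sub>m A"
  have B: "B \<in> carrier_mat n n" using A by (simp add: B_def)
  have "spectral_radius B < 1"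
  proof -
    from spectral_radius_mem_max(1)[OF B n] obtain e
      where e: "eigenvalue B e" "spectral_radius B = cmod e" by (auto simp: spectrum_def)
    then obtain v where v: "v \<in> carrier_vec n" "v \<noteq> 0\<^sub>v n" "B *\<^sub>v v = e \<cdot>\<^sub>v v"
      using B by (auto simp: eigenvalue_def eigenvector_def)
    have "complex_of_real s \<cdot>\<^sub>m B = A" using s A by (auto simp: B_def)
    hence "A *\<^sub>v v = (complex_of_real s \<cdot>\<^sub>m B) *\<^sub>v v" by simp
    also have "\<dots> = complex_of_real s \<cdot>\<^sub>v (B *\<^sub>v v)"
      using B v(1) by (intro eq_vecI) (auto simp: scalar_prod_def sum_distrib_left algebra_simps)
    also have "\<dots> = (complex_of_real s * e) \<cdot>\<^sub>v v" by (simp add: v smult_smult_assoc)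
    finally have "eigenvalue A (complex_of_real s * e)"
      using v A by (auto simp: eigenvalue_def eigenvector_def)
    hence "cmod (complex_of_real s * e) \<le> spectral_radius A"
      by (intro spectral_radius_mem_max(2)[OF A n] imageI) (simp add: spectrum_def)
    hence "s * cmod e \<le> spectral_radius A" using s by (simp add: norm_mult)
    with s have "s * cmod e < s * 1" by linarith
    hence "cmod e < 1" using s(1) by (simp only: mult_less_cancel_left_pos)
    with e show ?thesis by simp
  qed
  from spectral_radius_jnf_norm_bound_less_1_upper_triangular[OF B this]
  obtain c where c: "\<And>k. norm_bound (B ^\<^sub>m k) c" by blast
  have "norm_bound (A ^\<^sub>m k) (c * s ^ k)" for k
  proof -
    have dims: "dim_row (A ^\<^sub>m k) = n" "dim_col (A ^\<^sub>m k) = n"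
      using pow_carrier_mat[OF A, of k] by auto
    have "B ^\<^sub>m k = complex_of_real (1 / s) ^ k \<cdot>\<^sub>m (A ^\<^sub>m k)"
      unfolding B_def by (rule smult_pow_mat[OF A])
    with c[of k] have "\<forall>i j. i < n \<longrightarrow> j < n \<longrightarrow> (1 / s) ^ k * cmod ((A ^\<^sub>m k) $$ (i, j)) \<le> c"
      using s dims by (auto simp: norm_bound_def norm_mult norm_power norm_divide)
    thus ?thesis using s dims by (auto simp: norm_bound_def power_divide field_simps)
  qed
  thus ?thesis using s by blast
qed

lemma funpow_matrix_bound:
  fixes A :: "real ^ 'n::{finite,linorder} ^ 'n::{finite,linorder}"
  assumes "spectral_radius (complex_mat A) < 1"
  shows "\<exists>C \<rho>. 0 < C \<and> 0 < \<rho> \<and> \<rho> < 1 \<and> (\<forall>k v. norm (((*v) A ^^ k) v) \<le> C * \<rho> ^ k * norm v)"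
proof -
  from spectral_radius_less_1_pow_bound[OF complex_mat_carrier _ assms]
  obtain c \<rho> where \<rho>: "0 < \<rho>" "\<rho> < 1"
    and c: "\<And>k. norm_bound (complex_mat A ^\<^sub>m k) (c * \<rho> ^ k)" by auto
  define d where "d = real CARD('n)"
  have comp: "\<bar>((*v) A ^^ k) v $ ix i\<bar> \<le> d * (\<bar>c\<bar> * \<rho> ^ k * norm v)" if "i < CARD('n)" for k v i
  proof -
    let ?P = "complex_mat A ^\<^sub>m k"
    have P: "dim_row ?P = CARD('n)" "dim_col ?P = CARD('n)"
      by (rule carrier_matD[OF pow_carrier_mat[OF complex_mat_carrier]])+
    have "complex_of_real (((*v) A ^^ k) v $ ix i) = vec_index (complex_vec (((*v) A ^^ k) v)) i"
      using that by (simp add: complex_vec_def)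
    also have "\<dots> = vec_index (?P *\<^sub>v complex_vec v) i" by (simp add: complex_mat_pow_mult_vec)
    also have "\<dots> = (\<Sum>j<CARD('n). ?P $$ (i, j) * complex_of_real (v $ ix j))"
      using that P by (auto simp: complex_vec_def scalar_prod_def atLeast0LessThan)
    finally have "\<bar>((*v) A ^^ k) v $ ix i\<bar>
        = cmod (\<Sum>j<CARD('n). ?P $$ (i, j) * complex_of_real (v $ ix j))"
      by (metis norm_of_real real_norm_def)
    also have "\<dots> \<le> (\<Sum>j<CARD('n). \<bar>c\<bar> * \<rho> ^ k * norm v)"
    proof (rule sum_norm_le)
      fix j assume "j \<in> {..<CARD('n)}"
      hence "cmod (?P $$ (i, j)) \<le> c * \<rho> ^ k"
        using c[of k] that P unfolding norm_bound_def by auto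
      also have "\<dots> \<le> \<bar>c\<bar> * \<rho> ^ k" using \<rho> by (intro mult_right_mono) auto
      finally have "cmod (?P $$ (i, j)) \<le> \<bar>c\<bar> * \<rho> ^ k" .
      moreover have "\<bar>v $ ix j\<bar> \<le> norm v" by (rule component_le_norm_cart)
      ultimately show "cmod (?P $$ (i, j) * complex_of_real (v $ ix j)) \<le> \<bar>c\<bar> * \<rho> ^ k * norm v"
        using \<rho> by (simp add: norm_mult mult_mono)
    qed
    finally show ?thesis by (simp add: d_def)
  qed
  \<comment> \<open>Taking \<open>\<bar>c\<bar> + 1\<close> instead of \<open>c\<close> makes the
    constant strictly positive.\<close>
  have "norm (((*v) A ^^ k) v) \<le> (d * d * (\<bar>c\<bar> + 1)) * \<rho> ^ k * norm v" for k v
  proof -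
    have "norm (((*v) A ^^ k) v) \<le> (\<Sum>i\<in>UNIV. \<bar>((*v) A ^^ k) v $ i\<bar>)" by (rule norm_le_l1_cart)
    also have "\<dots> \<le> (\<Sum>i<CARD('n). d * (\<bar>c\<bar> * \<rho> ^ k * norm v))"
      unfolding sum_UNIV_ix by (intro sum_mono comp) auto
    also have "\<dots> = d * d * \<bar>c\<bar> * (\<rho> ^ k * norm v)" by (simp add: d_def)
    also have "\<dots> \<le> d * d * (\<bar>c\<bar> + 1) * (\<rho> ^ k * norm v)"
      using \<rho> by (intro mult_right_mono mult_left_mono) (auto simp: d_def)
    finally show ?thesis by (simp add: mult.assoc)
  qed
  moreover have "d * d * (\<bar>c\<bar> + 1) > 0" by (simp add: d_def add_nonneg_pos)
  ultimately show ?thesis using \<rho> by blast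
qed

section \<open>Roots of the characteristic polynomial\<close>

lemma companion_char_root_norm_less_1:
  fixes r :: "real ^ 'n::{finite,linorder}" and \<mu> :: complex
  assumes sr: "spectral_radius (complex_mat (companion r)) < 1"
    and root: "\<mu> ^ CARD('n) + (\<Sum>k<CARD('n). complex_of_real (r $ ix k) * \<mu> ^ k) = 0"
  shows "cmod \<mu> < 1"
proof -
  let ?A = "complex_mat (companion r)" and ?d = "CARD('n)"
  \<comment> \<open>The vector of powers of a root is an eigenvector of the companion matrix for
    that root.\<close>
  define v where "v = Matrix.vec ?d (\<lambda>k. \<mu> ^ k)"
  have "?A *\<^sub>v v = \<mu> \<cdot>\<^sub>v v"
  proof (rule eq_vecI)
    fix i assume "i < dim_vec (\<mu> \<cdot>\<^sub>v v)"
    hence i: "i < ?d" by (simp add: v_def)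
    have eq: "vec_index (?A *\<^sub>v v) i = (\<Sum>j<?d. ?A $$ (i, j) * \<mu> ^ j)"
      using i by (auto simp: v_def scalar_prod_def atLeast0LessThan complex_mat_def)
    show "vec_index (?A *\<^sub>v v) i = vec_index (\<mu> \<cdot>\<^sub>v v) i"
    proof (cases "Suc i = ?d")
      case True
      have "(\<Sum>j<?d. ?A $$ (i, j) * \<mu> ^ j) = - (\<Sum>k<?d. complex_of_real (r $ ix k) * \<mu> ^ k)"
        using i True by (simp add: complex_mat_def companion_def pos_ix flip: sum_negf)
      also have "\<dots> = \<mu> ^ Suc i" using root True by (simp add: add_eq_0_iff2)
      finally show ?thesis using i eq by (simp add: v_def)
    next
      case False
      hence "(\<Sum>j<?d. ?A $$ (i, j) * \<mu> ^ j) = (\<Sum>j<?d. if j = Suc i then \<mu> ^ j else 0)"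
        using i by (intro sum.cong) (auto simp: complex_mat_def companion_def pos_ix)
      also have "\<dots> = \<mu> ^ Suc i" using i False by simp
      finally show ?thesis using i eq by (simp add: v_def)
    qed
  qed (simp add: v_def complex_mat_def)
  moreover have "v \<noteq> 0\<^sub>v ?d"
  proof
    assume "v = 0\<^sub>v ?d"
    hence "vec_index v 0 = vec_index (0\<^sub>v ?d) 0" by simp
    thus False by (simp add: v_def)
  qed
  ultimately have "eigenvalue ?A \<mu>"
    unfolding eigenvalue_def eigenvector_def
    by (intro exI[of _ v]) (simp add: v_def complex_mat_def)
  hence "cmod \<mu> \<le> spectral_radius ?A"
    by (intro spectral_radius_mem_max(2)[OF complex_mat_carrier]) (auto simp: spectrum_def)
  with sr show ?thesis by simp
qed

text \<open>Up to sign the constant coefficient is the product of the roots; there is at least one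
  root and all have modulus below 1. The bound serves the surjectivity of
  \<open>srs_map r\<close>.\<close>

lemma companion_abs_first_less_1:
  fixes r :: "real ^ 'n::{finite,linorder}"
  assumes sr: "spectral_radius (complex_mat (companion r)) < 1"
  shows "\<bar>r $ ix 0\<bar> < 1"
proof -
  let ?d = "CARD('n)"
  define q where "q = (\<Sum>k<?d. monom (complex_of_real (r $ ix k)) k)"
  define p where "p = monom 1 ?d + q"
  have "degree q < ?d"
    unfolding q_def by (rule degree_sum_less) (auto intro: le_less_trans[OF degree_monom_le])
  hence deg: "degree p = ?d" and lead: "lead_coeff p = 1"
    by (auto simp: p_def degree_add_eq_left degree_monom_eq coeff_eq_0 lead_coeff_add_le)
  hence "p \<noteq> 0" by auto
  from alg_closed_imp_factorization[OF this, unfolded lead] obtain A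
    where A: "size A = ?d" "p = (\<Prod>x\<in>#A. [:-x, 1:])"
    using deg lead by auto
  have less: "cmod x < 1" if "x \<in># A" for x
  proof -
    have "poly p x = 0"
      using that by (subst A(2)) (auto simp: poly_prod_mset prod_mset_zero_iff)
    thus ?thesis
      by (intro companion_char_root_norm_less_1[OF sr])
        (simp add: p_def q_def poly_sum poly_monom)
  qed
  have "complex_of_real (r $ ix 0) = poly p 0"
    by (simp add: p_def q_def poly_sum poly_monom power_0_left if_distrib cong: if_cong)
  also have "\<dots> = (\<Prod>x\<in>#A. - x)" by (simp add: A(2) poly_prod_mset)
  finally have "\<bar>r $ ix 0\<bar> = cmod (\<Prod>x\<in>#A. - x)" by (metis norm_of_real real_norm_def)
  \<comment> \<open>The empty product is 1, so strictness is claimed for nonempty \<open>A'\<close>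
    only; the weak bound feeds the induction.\<close>
  moreover have "cmod (\<Prod>x\<in>#A'. - x) \<le> 1 \<and> (A' \<noteq> {#} \<longrightarrow> cmod (\<Prod>x\<in>#A'. - x) < 1)"
    if "A' \<subseteq># A" for A'
    using that
  proof (induction A')
    case (add x A')
    from add.prems have "x \<in># A" "A' \<subseteq># A"
      by (auto dest: mset_subset_eqD simp: mset_subset_eq_insertD subset_mset.less_imp_le)
    with add.IH less have "cmod x < 1" "cmod (\<Prod>x\<in>#A'. - x) \<le> 1" by auto
    hence "cmod x * cmod (\<Prod>x\<in>#A'. - x) \<le> cmod x" by (simp add: mult_left_le)
    with \<open>cmod x < 1\<close> show ?case by (simp add: norm_mult)
  qed auto
  moreover have "A \<noteq> {#}" using A(1) by auto
  ultimately show ?thesis by simp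
qed

section \<open>Shift radix systems and their tiles\<close>

lemma real_vec_nth [simp]: "real_vec z $ i = real_of_int (z $ i)"
  by (simp add: real_vec_def)

lemma real_vec_add [simp]: "real_vec (a + b) = real_vec a + real_vec b"
  and real_vec_diff [simp]: "real_vec (a - b) = real_vec a - real_vec b"
  and real_vec_0 [simp]: "real_vec 0 = 0"
  by (simp_all add: Finite_Cartesian_Product.vec_eq_iff)

lemma finite_int_vec_bounded: "finite {z :: int ^ 'n::finite. norm (real_vec z) \<le> B}"
proof (rule finite_subset)
  show "{z :: int ^ 'n. norm (real_vec z) \<le> B} \<subseteq> vec_lambda ` (UNIV \<rightarrow>\<^sub>E {- \<lceil>B\<rceil>..\<lceil>B\<rceil>})"
  proof
    fix z :: "int ^ 'n" assume "z \<in> {z. norm (real_vec z) \<le> B}"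
    hence "\<bar>real_of_int (z $ i)\<bar> \<le> B" for i
      using component_le_norm_cart[of "real_vec z" i] by simp
    hence "real_of_int \<bar>z $ i\<bar> \<le> real_of_int \<lceil>B\<rceil>" for i
      by (metis le_of_int_ceiling of_int_abs order_trans)
    hence "\<bar>z $ i\<bar> \<le> \<lceil>B\<rceil>" for i by (simp only: of_int_le_iff)
    hence "z $ i \<in> {- \<lceil>B\<rceil>..\<lceil>B\<rceil>}" for i
      using abs_le_D1 abs_le_D2 by (metis atLeastAtMost_iff minus_le_iff)
    thus "z \<in> vec_lambda ` (UNIV \<rightarrow>\<^sub>E {- \<lceil>B\<rceil>..\<lceil>B\<rceil>})"
      by (intro image_eqI[of _ _ "vec_nth z"]) auto
  qed
qed (intro finite_imageI finite_PiE; simp)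

lemma ex_int_vec_near:
  fixes v :: "real ^ 'n::finite"
  shows "\<exists>z. norm (real_vec z - v) \<le> CARD('n)"
proof
  have "norm (real_vec (\<chi> i. \<lfloor>v $ i\<rfloor>) - v) \<le> (\<Sum>i\<in>UNIV. \<bar>(real_vec (\<chi> i. \<lfloor>v $ i\<rfloor>) - v) $ i\<bar>)"
    by (rule norm_le_l1_cart)
  also have "\<dots> \<le> (\<Sum>i\<in>(UNIV :: 'n set). 1)"
    by (intro sum_mono) (simp add: abs_le_iff; linarith)
  finally show "norm (real_vec (\<chi> i. \<lfloor>v $ i\<rfloor>) - v) \<le> CARD('n)" by simp
qed

section \<open>The SRS map as a perturbed linear map\<close>

lemma pos_eq_iff: "pos i = k \<longleftrightarrow> i = ix k" if "k < CARD('n)" for i :: "'n::{finite,linorder}"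
  using that by (metis ix_pos(2) pos_ix)

lemma ix_last: "\<not> Suc (pos i) < CARD('n) \<longleftrightarrow> i = ix (CARD('n) - 1)" for i :: "'n::{finite,linorder}"
proof -
  have "\<not> Suc (pos i) < CARD('n) \<longleftrightarrow> pos i = CARD('n) - 1"
    using ix_pos(1)[of i] by linarith
  thus ?thesis by (simp add: pos_eq_iff)
qed

lemma companion_mult_nth:
  fixes r v :: "real ^ 'n::{finite,linorder}"
  shows "(companion r *v v) $ i = (if Suc (pos i) < CARD('n) then v $ ix (Suc (pos i)) else - (r \<bullet> v))"
proof (cases "Suc (pos i) < CARD('n)")
  case True
  have "(companion r *v v) $ i = (\<Sum>j\<in>UNIV. if j = ix (Suc (pos i)) then v $ j else 0)"
    using True by (simp add: matrix_vector_mult_def companion_def pos_eq_iff mult_delta_left)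
  thus ?thesis using True by simp
next
  case False
  hence "Suc (pos i) = CARD('n)" using ix_pos(1)[of i] by linarith
  thus ?thesis by (simp add: matrix_vector_mult_def companion_def inner_vec_def sum_negf)
qed

lemma srs_map_nth:
  fixes r :: "real ^ 'n::{finite,linorder}"
  shows "srs_map r z $ i =
    (if Suc (pos i) < CARD('n) then z $ ix (Suc (pos i)) else - \<lfloor>r \<bullet> real_vec z\<rfloor>)"
  by (simp add: srs_map_def inner_vec_def)

definition last_axis :: "real ^ 'n::{finite,linorder}" where
  "last_axis = axis (ix (CARD('n) - 1)) 1"

lemma norm_last_axis [simp]: "norm (last_axis :: real ^ 'n::{finite,linorder}) = 1"
  by (simp add: last_axis_def)

lemma last_axis_nth: "last_axis $ i = (if Suc (pos i) < CARD('n) then 0 else 1)"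
  for i :: "'n::{finite,linorder}"
  using ix_last[of i] by (auto simp: last_axis_def axis_def)

text \<open>Minus a floor is minus the number plus its fractional part, so one step is linear up to
  an error of length below 1 along \<open>last_axis\<close>. All comparisons of orbits start
  here.\<close>

lemma real_vec_srs_map:
  "real_vec (srs_map r z) = companion r *v real_vec z + frac (r \<bullet> real_vec z) *\<^sub>R last_axis"
  by (auto simp: Finite_Cartesian_Product.vec_eq_iff srs_map_nth companion_mult_nth last_axis_nth frac_def)

text \<open>The two fractional parts add up without a carry, so the floor is additive.\<close>

lemma srs_map_add:
  assumes "frac (r \<bullet> real_vec a) + frac (r \<bullet> real_vec b) < 1"
  shows "srs_map r (a + b) = srs_map r a + srs_map r b"
proof -
  have "\<lfloor>r \<bullet> real_vec a + r \<bullet> real_vec b\<rfloor> = \<lfloor>r \<bullet> real_vec a\<rfloor> + \<lfloor>r \<bullet> real_vec b\<rfloor>"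
    using assms by (simp add: floor_add)
  thus ?thesis by (simp add: Finite_Cartesian_Product.vec_eq_iff srs_map_nth inner_add_right)
qed

lemma srs_map_0 [simp]: "srs_map r 0 = 0"
  by (simp add: Finite_Cartesian_Product.vec_eq_iff srs_map_nth)

lemma funpow_srs_map_0 [simp]: "(srs_map r ^^ n) 0 = 0"
  by (induction n) auto

lemma linear_funpow_companion: "linear ((*v) (companion r) ^^ k)"
proof (induction k)
  case 0
  show ?case by (simp add: linear_id[unfolded id_def] id_def)
next
  case (Suc k)
  show ?case using linear_compose[OF Suc matrix_vector_mul_linear] by (simp add: comp_def)
qed

section \<open>Lower limits of sequences of sets\<close>

lemma closed_lower_limit: "closed (lower_limit A)"
proof -
  have "t \<in> lower_limit A" if t: "t \<in> closure (lower_limit A)" for t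
    unfolding lower_limit_def mem_Collect_eq
  proof (intro allI impI)
    fix U assume U: "open U \<and> t \<in> U"
    with t obtain s where "s \<in> U" "s \<in> lower_limit A"
      by (metis closure_iff_nhds_not_empty disjoint_iff order_refl)
    with U show "\<forall>\<^sub>F n in sequentially. U \<inter> A n \<noteq> {}" by (auto simp: lower_limit_def)
  qed
  thus ?thesis by (metis closure_subset closure_subset_eq subsetI)
qed

lemma mem_lower_limit_iff:
  fixes t :: "'a::metric_space"
  shows "t \<in> lower_limit A \<longleftrightarrow> (\<forall>e>0. \<forall>\<^sub>F n in sequentially. \<exists>a\<in>A n. dist a t < e)"
proof
  assume t: "t \<in> lower_limit A"
  show "\<forall>e>0. \<forall>\<^sub>F n in sequentially. \<exists>a\<in>A n. dist a t < e"
  proof (intro allI impI)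
    fix e :: real assume "e > 0"
    hence "\<forall>\<^sub>F n in sequentially. ball t e \<inter> A n \<noteq> {}"
      using t by (auto simp: lower_limit_def)
    thus "\<forall>\<^sub>F n in sequentially. \<exists>a\<in>A n. dist a t < e"
      by eventually_elim (auto simp: dist_commute)
  qed
next
  assume *: "\<forall>e>0. \<forall>\<^sub>F n in sequentially. \<exists>a\<in>A n. dist a t < e"
  show "t \<in> lower_limit A"
    unfolding lower_limit_def mem_Collect_eq
  proof (intro allI impI)
    fix U assume "open U \<and> t \<in> U"
    then obtain e where e: "e > 0" "\<And>s. dist s t < e \<Longrightarrow> s \<in> U" by (auto simp: open_dist)
    from *[rule_format, OF e(1)] show "\<forall>\<^sub>F n in sequentially. U \<inter> A n \<noteq> {}"
      by eventually_elim (use e(2) in blast)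
  qed
qed

text \<open>The decay constants are parameters, so that all later bounds refer to the same
  \<open>C\<close> and \<open>\<rho>\<close>. The assumption \<open>abs_first\<close> serves to find
  preimages under the SRS map.\<close>

locale contracting_srs =
  fixes r :: "real ^ 'n::{finite,linorder}" and C \<rho> :: real
  assumes first_nonzero: "r $ ix 0 \<noteq> 0"
    and abs_first: "\<bar>r $ ix 0\<bar> < 1"
    and C_pos: "0 < C"
    and rho: "0 < \<rho>" "\<rho> < 1"
    and pow_bound: "norm (((*v) (companion r) ^^ k) v) \<le> C * \<rho> ^ k * norm v"
begin

abbreviation "M \<equiv> (*v) (companion r)"
abbreviation "\<tau> \<equiv> srs_map r"
abbreviation "T \<equiv> srs_tile r"

definition R :: real where "R = C / (1 - \<rho>)"

lemma R_pos: "R > 0"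
  using C_pos rho by (simp add: R_def)

lemmas M_pow_linear = linear_funpow_companion[of _ r]
lemmas M_pow_diff = linear_diff[OF M_pow_linear]
lemmas M_pow_add = linear_add[OF M_pow_linear]
lemmas M_pow_scale = linear_cmul[OF M_pow_linear]

lemma rho_pow_le_1: "\<rho> ^ k \<le> 1"
  using rho by (simp add: power_le_one)

lemma M_pow_norm_le: "norm ((M ^^ k) v) \<le> C * norm v"
proof -
  have "norm ((M ^^ k) v) \<le> C * \<rho> ^ k * norm v" by (rule pow_bound)
  also have "\<dots> \<le> C * 1 * norm v"
    using C_pos rho_pow_le_1 by (intro mult_right_mono mult_left_mono) auto
  finally show ?thesis by simp
qed

lemma rho_pow_small: "e > 0 \<Longrightarrow> \<exists>N. \<forall>n\<ge>N. K * \<rho> ^ n < e"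
proof -
  assume "e > 0"
  have "(\<lambda>n. K * \<rho> ^ n) \<longlonglongrightarrow> 0"
    using rho by (intro tendsto_mult_right_zero LIMSEQ_power_zero) auto
  from order_tendstoD(2)[OF this \<open>e > 0\<close>] show ?thesis by (simp add: eventually_sequentially)
qed

text \<open>A preimage of \<open>x\<close> has all coordinates but the first prescribed. As the
  first one varies, \<open>r \<bullet> z\<close> runs through an arithmetic progression of step
  below 1 in modulus, which meets every half-open interval of length 1.\<close>

lemma surj_srs_map: "\<exists>z. \<tau> z = x"
proof -
  define c where "c = (\<Sum>j\<in>UNIV - {ix 0}. r $ j * real_of_int (x $ ix (pos j - 1)))"
  define l where "l = real_of_int (x $ ix (CARD('n) - 1))"
  \<comment> \<open>The real solution of \<open>r $ ix 0 * y + c = - l\<close>; it is rounded up or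
    down by the sign of \<open>r $ ix 0\<close>, so that the sum only grows, and by at most
    \<open>\<bar>r $ ix 0\<bar>\<close>.\<close>
  define y where "y = (- l - c) / r $ ix 0"
  have y: "r $ ix 0 * y = - l - c" using first_nonzero by (simp add: y_def)
  have "\<exists>k::int. - l \<le> r $ ix 0 * k + c \<and> r $ ix 0 * k + c < - l + 1"
  proof (cases "r $ ix 0 > 0")
    case True
    have "r $ ix 0 * y \<le> r $ ix 0 * \<lceil>y\<rceil>" "r $ ix 0 * \<lceil>y\<rceil> \<le> r $ ix 0 * (y + 1)"
      using True by (intro mult_left_mono; linarith)+
    thus ?thesis using y abs_first by (intro exI[of _ "\<lceil>y\<rceil>"]) (simp add: distrib_left)
  next
    case False
    have "r $ ix 0 * y \<le> r $ ix 0 * \<lfloor>y\<rfloor>" "r $ ix 0 * \<lfloor>y\<rfloor> \<le> r $ ix 0 * (y - 1)"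
      using False by (intro mult_left_mono_neg; linarith)+
    thus ?thesis using y abs_first by (intro exI[of _ "\<lfloor>y\<rfloor>"]) (simp add: right_diff_distrib)
  qed
  then obtain k :: int where k: "- l \<le> r $ ix 0 * k + c" "r $ ix 0 * k + c < - l + 1" by blast
  define z where "z = (\<chi> i :: 'n. if pos i = 0 then k else x $ ix (pos i - 1))"
  have "r \<bullet> real_vec z = r $ ix 0 * k + (\<Sum>j\<in>UNIV - {ix 0}. r $ j * real_of_int (z $ j))"
    by (simp add: inner_vec_def sum.remove[of UNIV "ix 0"] z_def pos_ix)
  also have "(\<Sum>j\<in>UNIV - {ix 0}. r $ j * real_of_int (z $ j)) = c"
    unfolding c_def by (intro sum.cong) (auto simp: z_def pos_eq_iff)
  finally have "\<lfloor>r \<bullet> real_vec z\<rfloor> = - x $ ix (CARD('n) - 1)"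
    using k by (simp add: floor_eq_iff l_def)
  hence "\<tau> z $ i = x $ i" for i
    by (cases "Suc (pos i) < CARD('n)")
      (use ix_last[of i] in \<open>auto simp: srs_map_nth z_def pos_ix ix_pos\<close>)
  hence "\<tau> z = x" by (simp add: Finite_Cartesian_Product.vec_eq_iff)
  thus ?thesis ..
qed

text \<open>The shift forces all coordinates of a kernel vector but the first to vanish, and the
  last row then gives \<open>r $ ix 0 * v $ ix 0 = 0\<close>.\<close>

lemma inj_M: "inj M"
proof -
  have "v = 0" if "M v = 0" for v
  proof -
    have *: "v $ j = 0" if "j \<noteq> ix 0" for j
    proof -
      have "pos j \<noteq> 0" using that by (simp add: pos_eq_iff)
      hence eq: "ix (Suc (pos (ix (pos j - 1) :: 'n))) = j" and "Suc (pos (ix (pos j - 1) :: 'n)) < CARD('n)"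
        using ix_pos[of j] by (auto simp: pos_ix)
      hence "M v $ ix (pos j - 1) = v $ j" by (simp add: companion_mult_nth)
      with \<open>M v = 0\<close> show ?thesis by simp
    qed
    have "M v $ ix (CARD('n) - 1) = - (r \<bullet> v)" by (simp add: companion_mult_nth pos_ix)
    hence "r \<bullet> v = 0" using \<open>M v = 0\<close> by simp
    moreover have "r \<bullet> v = r $ ix 0 * v $ ix 0"
      using * by (simp add: inner_vec_def sum.remove[of UNIV "ix 0"])
    ultimately have "v $ ix 0 = 0" using first_nonzero by simp
    with * show ?thesis by (metis Finite_Cartesian_Product.vec_eq_iff zero_index)
  qed
  thus ?thesis by (subst linear_injective_0) (auto simp: matrix_vector_mul_linear)
qed

lemma surj_M_pow: "\<exists>v. (M ^^ k) v = w"
proof -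
  have "surj M" by (intro linear_inj_imp_surj inj_M matrix_vector_mul_linear)
  hence "surj (M ^^ k)" by (rule surj_fn)
  thus ?thesis by (metis surjD)
qed

text \<open>This stands in for a norm bound on the inverse of \<open>M ^^ k\<close>; the constant
  depends on \<open>k\<close>.\<close>

lemma M_pow_bounded_below: "\<exists>c>0. \<forall>v. norm v \<le> c * norm ((M ^^ k) v)"
proof -
  have "inj (M ^^ k)" by (rule inj_fn[OF inj_M])
  from linear_inj_bounded_below_pos[OF M_pow_linear this]
  obtain B where B: "B > 0" "\<And>v. B * norm v \<le> norm ((M ^^ k) v)" by blast
  hence "norm v \<le> (1 / B) * norm ((M ^^ k) v)" for v
    using B(2)[of v] by (simp add: field_simps)
  thus ?thesis using B(1) by (intro exI[of _ "1 / B"]) auto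
qed

section \<open>Orbits of \<open>\<tau>\<close> compared with orbits of \<open>M\<close>\<close>

text \<open>
  \<open>R\<close> is the sum of the geometric series \<open>\<Sum>k. C * \<rho> ^ k\<close>. The factor \<open>M ^^ m\<close> is there so that the same
  estimate also compares \<open>M ^^ (m + n)\<close> with \<open>M ^^ m\<close> along a backward orbit.
\<close>

lemma srs_map_pow_near_M_pow:
  assumes "0 \<le> \<delta>" and "\<And>j. j < n \<Longrightarrow> frac (r \<bullet> real_vec ((\<tau> ^^ j) z)) \<le> \<delta>"
  shows "norm ((M ^^ m) (real_vec ((\<tau> ^^ n) z) - (M ^^ n) (real_vec z))) \<le> R * \<rho> ^ m * \<delta>"
  using assms
proof (induction n arbitrary: m)
  case 0
  have "0 \<le> R * \<rho> ^ m * \<delta>" using R_pos rho 0 by simp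
  then show ?case by (simp add: linear_0[OF M_pow_linear])
next
  case (Suc n)
  define f where "f = frac (r \<bullet> real_vec ((\<tau> ^^ n) z))"
  have f: "0 \<le> f" "f \<le> \<delta>" using Suc.prems(2)[of n] by (auto simp: f_def)
  have "real_vec ((\<tau> ^^ Suc n) z) - (M ^^ Suc n) (real_vec z)
      = M (real_vec ((\<tau> ^^ n) z) - (M ^^ n) (real_vec z)) + f *\<^sub>R last_axis"
    by (simp add: real_vec_srs_map f_def matrix_vector_mult_diff_distrib)
  hence eq: "(M ^^ m) (real_vec ((\<tau> ^^ Suc n) z) - (M ^^ Suc n) (real_vec z))
      = (M ^^ Suc m) (real_vec ((\<tau> ^^ n) z) - (M ^^ n) (real_vec z)) + f *\<^sub>R (M ^^ m) last_axis"
    by (simp only: M_pow_add M_pow_scale funpow_Suc_right comp_apply)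
  have "norm \<dots> \<le> R * \<rho> ^ Suc m * \<delta> + \<delta> * (C * \<rho> ^ m)"
  proof (rule norm_triangle_mono)
    show "norm ((M ^^ Suc m) (real_vec ((\<tau> ^^ n) z) - (M ^^ n) (real_vec z))) \<le> R * \<rho> ^ Suc m * \<delta>"
      using Suc.prems by (intro Suc.IH) auto
    show "norm (f *\<^sub>R (M ^^ m) last_axis) \<le> \<delta> * (C * \<rho> ^ m)"
      using f pow_bound[of m last_axis] by (simp add: mult_mono)
  qed
  \<comment> \<open>The induction closes because \<open>R * \<rho> + C = R\<close>.\<close>
  also have "\<dots> = R * \<rho> ^ m * \<delta>" using rho by (simp add: R_def field_simps)
  finally show ?case by (simp only: eq)
qed

lemma frac_le_1: "frac (x::real) \<le> 1"
  using frac_lt_1[of x] by simp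

lemma dist_M_pow:
  "norm ((M ^^ m) (real_vec ((\<tau> ^^ n) z) - (M ^^ n) (real_vec z))) \<le> R * \<rho> ^ m"
  using srs_map_pow_near_M_pow[of 1 n z m] by (simp add: frac_le_1)

section \<open>Approximation, compactness and covering property of the tiles\<close>

lemma mem_tile_iff:
  "t \<in> T x \<longleftrightarrow> (\<forall>e>0. \<forall>\<^sub>F n in sequentially. \<exists>z. (\<tau> ^^ n) z = x \<and> dist ((M ^^ n) (real_vec z)) t < e)"
  by (simp add: srs_tile_def mem_lower_limit_iff conj_commute)

lemma closed_tile: "closed (T x)"
  by (simp add: srs_tile_def closed_lower_limit)

text \<open>Follow a backward orbit of \<open>z\<close>. Its images under the matching powers of
  \<open>M\<close> form a Cauchy sequence by \<open>dist_M_pow\<close>, and the limit is a point of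
  the tile.\<close>

lemma ex_tile_point_near:
  assumes "(\<tau> ^^ n) z = x"
  shows "\<exists>p\<in>T x. dist ((M ^^ n) (real_vec z)) p \<le> R * \<rho> ^ n"
proof -
  from surj_srs_map obtain g where g: "\<And>y. \<tau> (g y) = y" by metis
  \<comment> \<open>Since \<open>g\<close> is a right inverse of \<open>\<tau>\<close>, this is one
    backward orbit of \<open>z\<close>.\<close>
  define w where "w k = (g ^^ k) z" for k
  define u where "u k = (M ^^ (n + k)) (real_vec (w k))" for k
  have \<tau>w: "(\<tau> ^^ l) (w (k + l)) = w k" for k l
  proof (induction l)
    case (Suc l)
    have "(\<tau> ^^ Suc l) (w (k + Suc l)) = (\<tau> ^^ l) (\<tau> (w (Suc (k + l))))"
      by (simp add: funpow_swap1)
    thus ?case using Suc g by (simp add: w_def)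
  qed simp
  have u_dist: "dist (u k) (u (k + l)) \<le> R * \<rho> ^ (n + k)" for k l
  proof -
    have "u k - u (k + l)
        = (M ^^ (n + k)) (real_vec ((\<tau> ^^ l) (w (k + l))) - (M ^^ l) (real_vec (w (k + l))))"
      unfolding \<tau>w u_def by (simp add: M_pow_diff funpow_add)
    thus ?thesis using dist_M_pow by (simp add: dist_norm)
  qed
  have "Cauchy u"
    unfolding Cauchy_altdef
  proof (intro allI impI)
    fix e :: real assume "e > 0"
    then obtain N where N: "\<And>k. k \<ge> N \<Longrightarrow> R * \<rho> ^ k < e" using rho_pow_small by blast
    have "dist (u k) (u l) < e" if "k \<ge> N" "l > k" for k l
      using u_dist[of k "l - k"] N[of "n + k"] that by simp
    thus "\<exists>N. \<forall>k\<ge>N. \<forall>l>k. dist (u k) (u l) < e" by blast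
  qed
  then obtain p where p: "u \<longlonglongrightarrow> p" by (auto simp: Cauchy_convergent_iff convergent_def)
  have "dist (u 0) p \<le> R * \<rho> ^ n"
  proof (rule tendsto_upperbound)
    show "(\<lambda>k. dist (u 0) (u k)) \<longlonglongrightarrow> dist (u 0) p" by (intro tendsto_intros p)
    show "\<forall>\<^sub>F k in sequentially. dist (u 0) (u k) \<le> R * \<rho> ^ n"
      using u_dist[of 0] by (intro always_eventually) simp
  qed simp
  moreover have "p \<in> T x"
    unfolding mem_tile_iff
  proof (intro allI impI)
    fix e :: real assume "e > 0"
    with p obtain K where K: "\<And>k. k \<ge> K \<Longrightarrow> dist (u k) p < e"
      by (meson metric_LIMSEQ_D)
    have "(\<tau> ^^ m) (w (m - n)) = x \<and> dist ((M ^^ m) (real_vec (w (m - n)))) p < e"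
      if "m \<ge> n + K" for m
    proof -
      have "(\<tau> ^^ (n + (m - n))) (w (m - n)) = x"
        using \<tau>w[of "m - n" 0] assms by (simp add: funpow_add w_def)
      thus ?thesis using K[of "m - n"] that by (simp add: u_def)
    qed
    thus "\<forall>\<^sub>F m in sequentially. \<exists>z. (\<tau> ^^ m) z = x \<and> dist ((M ^^ m) (real_vec z)) p < e"
      unfolding eventually_sequentially by blast
  qed
  ultimately show ?thesis by (auto simp: u_def w_def)
qed

text \<open>Approximate \<open>t\<close> at a much later level and push the preimage forward to
  level \<open>n\<close>. Together with \<open>ex_tile_point_near\<close>, the tile and its
  \<open>n\<close>-th approximation have Hausdorff distance at most
  \<open>R * \<rho> ^ n\<close>.\<close>

lemma ex_preimage_near:
  assumes "t \<in> T x" "e > 0"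
  shows "\<exists>z. (\<tau> ^^ n) z = x \<and> dist ((M ^^ n) (real_vec z)) t < R * \<rho> ^ n + e"
proof -
  from assms obtain N where "\<And>m. m \<ge> N \<Longrightarrow> \<exists>z. (\<tau> ^^ m) z = x \<and> dist ((M ^^ m) (real_vec z)) t < e"
    unfolding mem_tile_iff eventually_sequentially by blast
  from this[of "n + N"] obtain z
    where z: "(\<tau> ^^ (n + N)) z = x" "dist ((M ^^ (n + N)) (real_vec z)) t < e" by auto
  have "dist ((M ^^ n) (real_vec ((\<tau> ^^ N) z))) ((M ^^ (n + N)) (real_vec z)) \<le> R * \<rho> ^ n"
    using dist_M_pow[of n N z] by (simp add: dist_norm M_pow_diff funpow_add)
  with z(2) have "dist ((M ^^ n) (real_vec ((\<tau> ^^ N) z))) t < R * \<rho> ^ n + e"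
    using dist_triangle[of "(M ^^ n) (real_vec ((\<tau> ^^ N) z))" t "(M ^^ (n + N)) (real_vec z)"] by linarith
  moreover have "(\<tau> ^^ n) ((\<tau> ^^ N) z) = x" using z(1) by (simp add: funpow_add)
  ultimately show ?thesis by blast
qed

text \<open>At level 0 the only preimage is \<open>x\<close> itself. The bound does not depend on
  \<open>x\<close>, which yields local finiteness as well as boundedness.\<close>

lemma tile_near_base: "t \<in> T x \<Longrightarrow> dist (real_vec x) t \<le> R"
  by (rule field_le_epsilon) (use ex_preimage_near[of t x _ 0] in fastforce)

lemma compact_tile: "compact (T x)"
  unfolding compact_eq_bounded_closed bounded_def
  using closed_tile tile_near_base by blast

text \<open>Infinitely many levels suffice, although the lower limit asks for all late ones: each
  approximating preimage has a point of the closed tile within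
  \<open>R * \<rho> ^ n\<close>.\<close>

lemma mem_tile_if_limit_point:
  assumes "\<And>N e. e > 0 \<Longrightarrow> \<exists>n\<ge>N. \<exists>z. (\<tau> ^^ n) z = x \<and> dist ((M ^^ n) (real_vec z)) t < e"
  shows "t \<in> T x"
proof -
  have "\<exists>p\<in>T x. dist p t < e" if "e > 0" for e
  proof -
    from that have "e / 2 > 0" by simp
    then obtain N where N: "\<And>n. n \<ge> N \<Longrightarrow> R * \<rho> ^ n < e / 2" using rho_pow_small by blast
    obtain n z where z: "n \<ge> N" "(\<tau> ^^ n) z = x" "dist ((M ^^ n) (real_vec z)) t < e / 2"
      using assms[OF \<open>e / 2 > 0\<close>, of N] by blast
    obtain p where p: "p \<in> T x" "dist ((M ^^ n) (real_vec z)) p \<le> R * \<rho> ^ n"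
      using ex_tile_point_near[OF z(2)] by blast
    have "dist p t < e"
      using p(2) N[OF z(1)] z(3) dist_triangle3[of p t "(M ^^ n) (real_vec z)"] by linarith
    with p(1) show ?thesis by blast
  qed
  thus ?thesis using closed_tile closure_approachable closure_closed by metis
qed

lemma ex_subseq_const:
  fixes y :: "nat \<Rightarrow> int ^ 'n::{finite,linorder}"
  assumes "\<And>k. norm (real_vec (y k)) \<le> B"
  shows "\<exists>a. \<forall>N. \<exists>k\<ge>N. y k = a"
proof -
  have "range y \<subseteq> {z. norm (real_vec z) \<le> B}" using assms by auto
  hence "finite (range y)" using finite_int_vec_bounded finite_subset by blast
  from pigeonhole_infinite[OF infinite_UNIV_nat this]
  obtain a where "infinite {k. y k = y a}" by auto
  thus ?thesis unfolding infinite_nat_iff_unbounded_le by auto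
qed

text \<open>This is the useful half of the set equation for tiles. Preimages \<open>z k\<close> of
  \<open>x\<close> at level \<open>n + k\<close> approximating \<open>(M ^^ n) s\<close> have
  bounded images \<open>y k\<close> at level \<open>n\<close>, so one value \<open>a\<close> recurs;
  along it \<open>(M ^^ k) (z k)\<close> tends to \<open>s\<close>.\<close>

lemma mem_tile_M_pow_imp:
  assumes "(M ^^ n) s \<in> T x"
  shows "\<exists>y. (\<tau> ^^ n) y = x \<and> s \<in> T y"
proof -
  \<comment> \<open>The tolerance is \<open>\<rho> ^ k\<close>, so that both error terms decay at
    the same rate.\<close>
  have "\<exists>z. (\<tau> ^^ (n + k)) z = x \<and> dist ((M ^^ (n + k)) (real_vec z)) ((M ^^ n) s) < R * \<rho> ^ (n + k) + \<rho> ^ k" for k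
    using ex_preimage_near[OF assms] rho by simp
  then obtain z where z: "\<And>k. (\<tau> ^^ (n + k)) (z k) = x"
      "\<And>k. dist ((M ^^ (n + k)) (real_vec (z k))) ((M ^^ n) s) < R * \<rho> ^ (n + k) + \<rho> ^ k" by metis
  obtain c where c: "c > 0" "\<And>v. norm v \<le> c * norm ((M ^^ n) v)" using M_pow_bounded_below by blast
  have near: "dist ((M ^^ k) (real_vec (z k))) s \<le> c * (R + 1) * \<rho> ^ k" for k
  proof -
    have "dist ((M ^^ k) (real_vec (z k))) s \<le> c * dist ((M ^^ (n + k)) (real_vec (z k))) ((M ^^ n) s)"
      using c(2)[of "(M ^^ k) (real_vec (z k)) - s"] by (simp add: dist_norm M_pow_diff funpow_add)
    also have "\<dots> \<le> c * (R * (\<rho> ^ n * \<rho> ^ k) + \<rho> ^ k)"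
      using z(2)[of k] c(1) by (intro mult_left_mono) (auto simp: power_add)
    also have "\<dots> \<le> c * (R * (1 * \<rho> ^ k) + \<rho> ^ k)"
      using c(1) R_pos rho rho_pow_le_1 by (intro mult_left_mono add_right_mono mult_right_mono) auto
    finally show ?thesis by (simp add: algebra_simps)
  qed
  define y where "y k = (\<tau> ^^ k) (z k)" for k
  have "norm (real_vec (y k)) \<le> R + (c * (R + 1) + norm s)" for k
  proof -
    have "norm (real_vec (y k) - (M ^^ k) (real_vec (z k))) \<le> R"
      using dist_M_pow[of 0 k "z k"] by (simp add: y_def)
    moreover have "c * (R + 1) * \<rho> ^ k \<le> c * (R + 1)"
      using c(1) R_pos rho_pow_le_1[of k] by (simp add: mult_left_le)
    ultimately show ?thesis
      using near[of k] norm_triangle_sub[of "real_vec (y k)" "(M ^^ k) (real_vec (z k))"]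
        norm_triangle_sub[of "(M ^^ k) (real_vec (z k))" s] unfolding dist_norm by linarith
  qed
  then obtain a where a: "\<And>N. \<exists>k\<ge>N. y k = a" using ex_subseq_const by blast
  obtain k where "y k = a" using a by blast
  hence "(\<tau> ^^ n) a = x" using z(1)[of k] by (auto simp: y_def funpow_add)
  moreover have "s \<in> T a"
  proof (rule mem_tile_if_limit_point)
    fix N and e :: real assume "e > 0"
    then obtain N' where N': "\<And>k. k \<ge> N' \<Longrightarrow> c * (R + 1) * \<rho> ^ k < e" using rho_pow_small by blast
    obtain k where "k \<ge> max N N'" "y k = a" using a by blast
    thus "\<exists>k\<ge>N. \<exists>z. (\<tau> ^^ k) z = a \<and> dist ((M ^^ k) (real_vec z)) s < e"
      using near[of k] N'[of k] by (intro exI[of _ k] conjI exI[of _ "z k"]) (auto simp: y_def)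
  qed
  ultimately show ?thesis by blast
qed

text \<open>Round the preimage of \<open>t\<close> under \<open>M ^^ k\<close> to an integer vector;
  \<open>M ^^ k\<close> contracts the rounding error. The points \<open>(\<tau> ^^ k) (z k)\<close>
  stay bounded, and a recurring value is the index of a tile containing \<open>t\<close>.\<close>

lemma tiles_cover: "\<exists>x. t \<in> T x"
proof -
  define d where "d = real CARD('n)"
  have "\<exists>z. dist ((M ^^ k) (real_vec z)) t \<le> C * d * \<rho> ^ k" for k
  proof -
    obtain u where u: "(M ^^ k) u = t" using surj_M_pow by blast
    obtain z where z: "norm (real_vec z - u) \<le> d" using ex_int_vec_near[of u] by (auto simp: d_def)
    have "dist ((M ^^ k) (real_vec z)) t = norm ((M ^^ k) (real_vec z - u))"
      by (simp add: dist_norm M_pow_diff u)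
    also have "\<dots> \<le> C * \<rho> ^ k * norm (real_vec z - u)" by (rule pow_bound)
    also have "\<dots> \<le> C * \<rho> ^ k * d" using z C_pos rho by (intro mult_left_mono) auto
    finally show ?thesis by (auto simp: mult_ac)
  qed
  then obtain z where z: "\<And>k. dist ((M ^^ k) (real_vec (z k))) t \<le> C * d * \<rho> ^ k" by metis
  have "norm (real_vec ((\<tau> ^^ k) (z k))) \<le> R + (C * d + norm t)" for k
  proof -
    have "norm (real_vec ((\<tau> ^^ k) (z k)) - (M ^^ k) (real_vec (z k))) \<le> R"
      using dist_M_pow[of 0 k "z k"] by simp
    moreover have "C * d * \<rho> ^ k \<le> C * d"
      using C_pos rho_pow_le_1[of k] by (simp add: mult_left_le d_def)
    ultimately show ?thesis
      using z[of k] norm_triangle_sub[of "real_vec ((\<tau> ^^ k) (z k))" "(M ^^ k) (real_vec (z k))"]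
        norm_triangle_sub[of "(M ^^ k) (real_vec (z k))" t] unfolding dist_norm by linarith
  qed
  then obtain a where a: "\<And>N. \<exists>k\<ge>N. (\<tau> ^^ k) (z k) = a"
    using ex_subseq_const[of "\<lambda>k. (\<tau> ^^ k) (z k)"] by blast
  have "t \<in> T a"
  proof (rule mem_tile_if_limit_point)
    fix N and e :: real assume "e > 0"
    then obtain N' where N': "\<And>k. k \<ge> N' \<Longrightarrow> C * d * \<rho> ^ k < e" using rho_pow_small by blast
    obtain k where "k \<ge> max N N'" "(\<tau> ^^ k) (z k) = a" using a by blast
    thus "\<exists>k\<ge>N. \<exists>z. (\<tau> ^^ k) z = a \<and> dist ((M ^^ k) (real_vec z)) t < e"
      using z[of k] N'[of k] by (intro exI[of _ k] conjI exI[of _ "z k"]) auto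
  qed
  thus ?thesis ..
qed

lemma finite_tiles_meeting_ball: "finite {x. ball c e \<inter> T x \<noteq> {}}"
proof (rule finite_subset[OF _ finite_int_vec_bounded])
  show "{x. ball c e \<inter> T x \<noteq> {}} \<subseteq> {x. norm (real_vec x) \<le> norm c + e + R}"
  proof
    fix x assume "x \<in> {x. ball c e \<inter> T x \<noteq> {}}"
    then obtain p where "dist c p < e" "p \<in> T x" by auto
    with tile_near_base have "dist c p < e" "dist (real_vec x) p \<le> R" by auto
    hence "norm (real_vec x) \<le> norm c + e + R"
      using norm_triangle_sub[of "real_vec x" c] dist_triangle2[of "real_vec x" c p]
      unfolding dist_norm[symmetric] by linarith
    thus "x \<in> {x. norm (real_vec x) \<le> norm c + e + R}" by simp
  qed
qed

lemma finite_tiles_at: "finite {x. t \<in> T x}"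
  by (rule finite_subset[OF _ finite_tiles_meeting_ball[of t 1]]) (force simp: disjoint_iff)

lemma compact_locally_finite_cover_tiles: "compact_locally_finite_cover T"
  unfolding compact_locally_finite_cover_def
  using compact_tile finite_tiles_meeting_ball tiles_cover by auto

section \<open>Relative density of points of small covering degree\<close>

definition small_fracs_dense :: "nat \<Rightarrow> real \<Rightarrow> bool" where
  "small_fracs_dense n \<delta> \<longleftrightarrow>
    (\<exists>L. \<forall>z0. \<exists>z. norm (real_vec (z - z0)) \<le> L \<and> (\<forall>k<n. frac (r \<bullet> real_vec ((\<tau> ^^ k) z)) < \<delta>))"

text \<open>
  If the fractional parts along the orbit of \<open>z\<close> are small enough, then
  \<open>\<tau>\<close> is additive on the first \<open>n\<close> steps of \<open>w + z\<close> for all \<open>w\<close> in a prescribed finite set. Hence the tiles near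
  \<open>t + (\<tau> ^^ n) z\<close> are approximate translates of the tiles near \<open>t\<close>.
\<close>

lemma covering_degree_at_relatively_dense:
  assumes small: "\<And>n \<delta>. \<delta> > 0 \<Longrightarrow> small_fracs_dense n \<delta>"
  shows "\<exists>L. \<forall>c. \<exists>s. dist c s < L \<and> covering_degree_at T s \<le> covering_degree_at T t"
proof -
  \<comment> \<open>Only finitely many tiles come near \<open>t\<close> without containing it, and
    they are closed; so all tiles meeting a small ball around \<open>t\<close> contain
    \<open>t\<close>.\<close>
  define F1 where "F1 = {y. ball t 1 \<inter> T y \<noteq> {} \<and> t \<notin> T y}"
  have "finite F1"
    unfolding F1_def by (rule finite_subset[OF _ finite_tiles_meeting_ball[of t 1]]) auto
  hence "open (- (\<Union>y\<in>F1. T y))" by (intro open_Compl closed_UN) (auto simp: closed_tile)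
  moreover have "t \<in> - (\<Union>y\<in>F1. T y)" by (auto simp: F1_def)
  ultimately obtain e1 where e1: "e1 > 0" "ball t e1 \<subseteq> - (\<Union>y\<in>F1. T y)"
    unfolding open_contains_ball by blast
  define e where "e = min 1 e1"
  have e: "e > 0" "\<And>y p. p \<in> T y \<Longrightarrow> dist t p < e \<Longrightarrow> t \<in> T y"
  proof -
    fix y p assume p: "p \<in> T y" "dist t p < e"
    hence "ball t 1 \<inter> T y \<noteq> {}" "p \<in> ball t e1" by (auto simp: e_def)
    with p e1(2) have "y \<notin> F1" by blast
    with \<open>ball t 1 \<inter> T y \<noteq> {}\<close> show "t \<in> T y" by (simp add: F1_def)
  qed (use e1 in \<open>simp add: e_def\<close>)
  obtain n where n: "R * \<rho> ^ n < e / 6" using rho_pow_small[of "e / 6" R] e(1) by fastforce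
  obtain b where b: "b > 0" "\<And>v. norm v \<le> b * norm ((M ^^ n) v)" using M_pow_bounded_below by blast
  \<comment> \<open>If \<open>(M ^^ n) w\<close> is near \<open>t\<close>, then the linear orbit of
    \<open>w\<close> stays within \<open>D\<close>, and its \<open>\<tau>\<close>-orbit in the
    finite set \<open>F\<close> defined below.\<close>
  define D where "D = C * (b * (norm t + e))"
  have M_pow_le_D: "norm ((M ^^ k) w) \<le> D" if "norm ((M ^^ n) w) \<le> norm t + e" for k w
  proof -
    have "norm ((M ^^ k) w) \<le> C * norm w" by (rule M_pow_norm_le)
    also have "norm w \<le> b * (norm t + e)"
      using b(2)[of w] that b(1) by (meson mult_left_mono order_trans less_imp_le)
    finally show ?thesis using C_pos by (simp add: D_def)
  qed
  define F where "F = {v :: int ^ 'n::{finite,linorder}. norm (real_vec v) \<le> D + R}"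
  have "finite F" unfolding F_def by (rule finite_int_vec_bounded)
  \<comment> \<open>The first entry puts \<open>(\<tau> ^^ n) z\<close> within \<open>e / 6\<close>
    of \<open>(M ^^ n) z\<close>; the others exclude carries against all vectors of
    \<open>F\<close>.\<close>
  define \<delta> where "\<delta> = Min (insert (e / (6 * R)) ((\<lambda>v. 1 - frac (r \<bullet> real_vec v)) ` F))"
  have "\<delta> \<in> insert (e / (6 * R)) ((\<lambda>v. 1 - frac (r \<bullet> real_vec v)) ` F)"
    unfolding \<delta>_def using \<open>finite F\<close> by (intro Min_in) auto
  hence "\<delta> > 0" using e(1) R_pos by (auto simp: frac_lt_1)
  have "\<delta> \<le> e / (6 * R)" unfolding \<delta>_def using \<open>finite F\<close> by (intro Min_le) auto
  hence R\<delta>: "R * \<delta> \<le> e / 6" using R_pos by (simp add: field_simps)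
  have F: "\<delta> \<le> 1 - frac (r \<bullet> real_vec v)" if "v \<in> F" for v
    unfolding \<delta>_def using \<open>finite F\<close> that by (intro Min_le) auto
  obtain L where L: "\<And>z0. \<exists>z. norm (real_vec (z - z0)) \<le> L \<and>
      (\<forall>k<n. frac (r \<bullet> real_vec ((\<tau> ^^ k) z)) < \<delta>)"
    using small[OF \<open>\<delta> > 0\<close>] unfolding small_fracs_dense_def by blast
  define d where "d = real CARD('n)"
  have "\<exists>s. dist c s < C * (d + L) + R + 1 \<and> covering_degree_at T s \<le> covering_degree_at T t" for c
  proof -
    \<comment> \<open>With \<open>z\<close> near \<open>u\<close>, the point \<open>x\<close> is
      near \<open>c - t\<close>, so that \<open>s = t + x\<close> is near \<open>c\<close>.\<close>
    obtain u where u: "(M ^^ n) u = c - t" using surj_M_pow by blast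
    obtain z0 where z0: "norm (real_vec z0 - u) \<le> d" using ex_int_vec_near[of u] by (auto simp: d_def)
    obtain z where z: "norm (real_vec (z - z0)) \<le> L" "\<And>k. k < n \<Longrightarrow> frac (r \<bullet> real_vec ((\<tau> ^^ k) z)) < \<delta>"
      using L by blast
    define x where "x = (\<tau> ^^ n) z"
    define s where "s = t + real_vec x"
    have x: "norm (real_vec x - (M ^^ n) (real_vec z)) \<le> e / 6"
      using srs_map_pow_near_M_pow[of \<delta> n z 0] z(2) \<open>\<delta> > 0\<close> R\<delta> by (simp add: x_def less_imp_le)
    have "norm (u - real_vec z) \<le> d + L"
      using z0 z(1) norm_triangle_ineq4[of "u - real_vec z0" "real_vec z - real_vec z0"]
      by (simp add: norm_minus_commute)
    hence "norm ((M ^^ n) (u - real_vec z)) \<le> C * (d + L)"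
      using M_pow_norm_le[of n "u - real_vec z"] C_pos by (meson mult_left_mono order_trans less_imp_le)
    moreover have "norm (real_vec x - (M ^^ n) (real_vec z)) \<le> R"
      using dist_M_pow[of 0 n z] by (simp add: x_def)
    moreover have "c - s = (M ^^ n) (u - real_vec z) - (real_vec x - (M ^^ n) (real_vec z))"
      by (simp add: s_def M_pow_diff u)
    ultimately have "dist c s < C * (d + L) + R + 1"
      unfolding dist_norm
      using norm_triangle_ineq4[of "(M ^^ n) (u - real_vec z)" "real_vec x - (M ^^ n) (real_vec z)"]
      by simp
    moreover have "{y. s \<in> T y} \<subseteq> (\<lambda>y. y + x) ` {y. t \<in> T y}"
    proof
      fix y' assume "y' \<in> {y. s \<in> T y}"
      then obtain w' where w': "(\<tau> ^^ n) w' = y'" "dist ((M ^^ n) (real_vec w')) s < R * \<rho> ^ n + e / 6"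
        using ex_preimage_near[of s y' "e / 6" n] e(1) by auto
      define w where "w = w' - z"
      have eq: "(M ^^ n) (real_vec w) - t
          = ((M ^^ n) (real_vec w') - s) + (real_vec x - (M ^^ n) (real_vec z))"
        by (simp add: w_def s_def M_pow_diff)
      have near: "norm ((M ^^ n) (real_vec w) - t) < e / 2"
        unfolding eq using norm_triangle_ineq[of "(M ^^ n) (real_vec w') - s" "real_vec x - (M ^^ n) (real_vec z)"]
          w'(2) x n unfolding dist_norm by linarith
      hence le: "norm ((M ^^ n) (real_vec w)) \<le> norm t + e"
        using norm_triangle_sub[of "(M ^^ n) (real_vec w)" t] e(1) by linarith
      \<comment> \<open>No carry occurs along the orbits of \<open>w\<close> and \<open>z\<close>,
        so the system acts additively on \<open>w' = w + z\<close>.\<close>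
      have "k \<le> n \<Longrightarrow> (\<tau> ^^ k) w' = (\<tau> ^^ k) w + (\<tau> ^^ k) z" for k
      proof (induction k)
        case 0
        show ?case by (simp add: w_def)
      next
        case (Suc k)
        have "norm (real_vec ((\<tau> ^^ k) w)) \<le> D + R"
          using norm_triangle_sub[of "real_vec ((\<tau> ^^ k) w)" "(M ^^ k) (real_vec w)"]
            M_pow_le_D[OF le, of k] dist_M_pow[of 0 k w] by simp
        hence "\<delta> \<le> 1 - frac (r \<bullet> real_vec ((\<tau> ^^ k) w))" by (intro F) (simp add: F_def)
        moreover have "frac (r \<bullet> real_vec ((\<tau> ^^ k) z)) < \<delta>" using z(2) Suc.prems by simp
        ultimately have "frac (r \<bullet> real_vec ((\<tau> ^^ k) w)) + frac (r \<bullet> real_vec ((\<tau> ^^ k) z)) < 1"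
          by linarith
        from srs_map_add[OF this] show ?case using Suc by simp
      qed
      from this[of n] have y: "y' = (\<tau> ^^ n) w + x" by (simp add: w' x_def)
      obtain p where p: "p \<in> T ((\<tau> ^^ n) w)" "dist ((M ^^ n) (real_vec w)) p \<le> R * \<rho> ^ n"
        using ex_tile_point_near[OF refl] by blast
      have "dist t p < e"
        using dist_triangle3[of t p "(M ^^ n) (real_vec w)"] near p(2) n e(1)
        unfolding dist_norm[of _ t] by linarith
      with p(1) e(2) have "t \<in> T ((\<tau> ^^ n) w)" by blast
      with y show "y' \<in> (\<lambda>y. y + x) ` {y. t \<in> T y}" by blast
    qed
    hence "card {y. s \<in> T y} \<le> card {y. t \<in> T y}"
      using finite_tiles_at by (meson card_image_le card_mono finite_imageI order_trans)
    ultimately show ?thesis unfolding covering_degree_at_def by blast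
  qed
  thus ?thesis by blast
qed

section \<open>From the covering degree to weak tilings\<close>

lemma covering_degree_at_pos: "covering_degree_at T t > 0"
  unfolding covering_degree_at_def using tiles_cover[of t] finite_tiles_at[of t] by (auto simp: card_gt_0_iff)

lemma ex_covering_degree: "\<exists>t. covering_degree_at T t = covering_degree T"
  unfolding covering_degree_def by (metis Inf_nat_def1 UNIV_not_empty image_iff image_is_empty)

text \<open>Pull a ball inside too many tiles back by \<open>M ^^ n\<close> until it contains a
  point \<open>s\<close> of minimal degree. The set equation gives one tile through \<open>s\<close>
  for each of these tiles, which is too many.\<close>

lemma weak_m_tiling_tiles:
  assumes "\<And>n \<delta>. \<delta> > 0 \<Longrightarrow> small_fracs_dense n \<delta>"
  shows "weak_m_tiling (covering_degree T) T"
proof -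
  obtain t where t: "covering_degree_at T t = covering_degree T" using ex_covering_degree by blast
  obtain L where L: "\<And>c. \<exists>s. dist c s < L \<and> covering_degree_at T s \<le> covering_degree T"
    using covering_degree_at_relatively_dense[OF assms, of t] t by auto
  have "(\<Inter>i\<in>J. interior (T i)) = {}" if J: "finite J" "card J = covering_degree T + 1" for J
  proof (rule ccontr)
    assume "(\<Inter>i\<in>J. interior (T i)) \<noteq> {}"
    then obtain q where "q \<in> (\<Inter>i\<in>J. interior (T i))" by blast
    moreover have "open (\<Inter>i\<in>J. interior (T i))" using J(1) by (intro open_INT) auto
    ultimately obtain e where e: "e > 0" "ball q e \<subseteq> (\<Inter>i\<in>J. interior (T i))"
      unfolding open_contains_ball by blast
    obtain n where n: "C * L * \<rho> ^ n < e" using rho_pow_small[of e "C * L"] e(1) by fastforce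
    obtain c where c: "(M ^^ n) c = q" using surj_M_pow by blast
    obtain s where s: "dist c s < L" "covering_degree_at T s \<le> covering_degree T" using L by blast
    have "dist q ((M ^^ n) s) \<le> C * \<rho> ^ n * dist c s"
      using pow_bound[of n "c - s"] by (simp add: dist_norm M_pow_diff c)
    also have "\<dots> \<le> C * \<rho> ^ n * L" using s(1) C_pos rho by (intro mult_left_mono) auto
    also have "\<dots> < e" using n by (simp add: mult_ac)
    finally have "(M ^^ n) s \<in> T i" if "i \<in> J" for i
      using e(2) that interior_subset by fastforce
    hence "\<forall>i\<in>J. \<exists>y. (\<tau> ^^ n) y = i \<and> s \<in> T y" using mem_tile_M_pow_imp by blast
    then obtain y where y: "\<And>i. i \<in> J \<Longrightarrow> (\<tau> ^^ n) (y i) = i" "\<And>i. i \<in> J \<Longrightarrow> s \<in> T (y i)" by metis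
    \<comment> \<open>Different tiles have different \<open>y\<close>, since
      \<open>\<tau> ^^ n\<close> recovers the index.\<close>
    have "inj_on y J" using y(1) by (metis inj_onI)
    hence "card J = card (y ` J)" by (simp add: card_image)
    also have "\<dots> \<le> card {x. s \<in> T x}" using y(2) finite_tiles_at by (intro card_mono) auto
    finally show False using s(2) J(2) by (simp add: covering_degree_at_def)
  qed
  thus ?thesis using compact_locally_finite_cover_tiles by (simp add: weak_m_tiling_def)
qed

text \<open>As \<open>M\<close> fixes 0, the set equation yields \<open>y\<close> with
  \<open>(\<tau> ^^ N) y = x\<close> and \<open>0 \<in> T y\<close> for any \<open>N\<close>. There
  are finitely many such \<open>y\<close>, so a large \<open>N\<close> sends all of them to
  0.\<close>

lemma zero_mem_tile_iff:
  assumes "finiteness_property r"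
  shows "0 \<in> T x \<longleftrightarrow> x = 0"
proof -
  have *: "x = 0" if "0 \<in> T x" for x
  proof -
    from assms obtain h where h: "\<And>z. (\<tau> ^^ h z) z = 0" unfolding finiteness_property_def by metis
    \<comment> \<open>The sum serves as a common upper bound of the hitting times.\<close>
    define N where "N = (\<Sum>z\<in>{z. 0 \<in> T z}. h z)"
    have "(M ^^ N) 0 \<in> T x" using that by (simp add: linear_0[OF M_pow_linear])
    then obtain y where y: "(\<tau> ^^ N) y = x" "0 \<in> T y" using mem_tile_M_pow_imp by blast
    have "h y \<le> N" unfolding N_def using y(2) finite_tiles_at by (intro member_le_sum) auto
    hence "(\<tau> ^^ N) y = (\<tau> ^^ (N - h y)) ((\<tau> ^^ h y) y)"
      by (metis comp_apply funpow_add le_add_diff_inverse2)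
    with y h show ?thesis by simp
  qed
  moreover obtain z where "0 \<in> T z" using tiles_cover by blast
  ultimately show ?thesis by blast
qed

lemma covering_degree_eq_1:
  assumes "finiteness_property r"
  shows "covering_degree T = 1"
proof -
  have "covering_degree T \<le> covering_degree_at T 0"
    unfolding covering_degree_def by (rule cINF_lower) auto
  also have "\<dots> = 1" by (simp add: covering_degree_at_def zero_mem_tile_iff[OF assms])
  finally have "covering_degree T \<le> 1" .
  moreover obtain t where "covering_degree_at T t = covering_degree T" using ex_covering_degree by blast
  ultimately show ?thesis using covering_degree_at_pos[of t] by linarith
qed

end

section \<open>Minimal polynomials of algebraic integers, Kronecker approximation, algebraic independence\<close>

lemma ex_common_denominator:
  fixes S :: "'a::field_char_0 set"
  assumes "finite S" "\<And>x. x \<in> S \<Longrightarrow> x \<in> \<rat>"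
  shows "\<exists>q::int. q > 0 \<and> (\<forall>x\<in>S. of_int q * x \<in> \<int>)"
  using assms
proof (induction S rule: finite_induct)
  case (insert x S)
  then obtain q :: int where q: "q > 0" "\<forall>y\<in>S. of_int q * y \<in> \<int>" by auto
  from insert.prems have "x \<in> \<rat>" by simp
  then obtain a b :: int where ab: "b > 0" "x = of_int a / of_int b" by (auto elim: Rats_cases')
  have "of_int (b * q) * y = of_int b * (of_int q * y)" for y :: 'a by simp
  hence "of_int (b * q) * y \<in> \<int>" if "y \<in> S" for y
    using q(2) that by (metis Ints_mult Ints_of_int)
  moreover have "of_int (b * q) * x = of_int (q * a)" using ab by simp
  hence "of_int (b * q) * x \<in> \<int>" by (metis Ints_of_int)
  ultimately show ?case using q(1) ab(1) by (intro exI[of _ "b * q"]) auto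
qed (auto intro: exI[of _ 1])

lemma ex_primitive_int_multiple:
  fixes p :: "rat poly"
  assumes "lead_coeff p = 1"
  shows "\<exists>a P. a > 0 \<and> content P = 1 \<and> of_int_poly P = Polynomial.smult (of_int a) p"
proof -
  have "x \<in> \<rat>" for x :: rat
    by (cases x) (auto simp: Fract_of_int_quotient)
  then obtain q :: int where q: "q > 0" "\<forall>x\<in>set (coeffs p). of_int q * x \<in> \<int>"
    using ex_common_denominator[of "set (coeffs p)"] by blast
  have "of_int q * coeff p i \<in> \<int>" for i
  proof (cases "coeff p i = 0")
    case False
    hence "coeff p i \<in> set (coeffs p)" by (intro coeff_in_coeffs le_degree) auto
    with q(2) show ?thesis by blast
  qed simp
  hence fl: "of_int \<lfloor>of_int q * coeff p i\<rfloor> = of_int q * coeff p i" for i by (simp add: of_int_floor_cancel)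
  define Q where "Q = map_poly (\<lambda>x. \<lfloor>of_int q * x\<rfloor>) p"
  have Q: "of_int_poly Q = Polynomial.smult (of_int q) p"
    by (rule poly_eqI) (simp add: Q_def coeff_map_poly fl)
  define P where "P = primitive_part Q"
  define a where "a = lead_coeff P"
  have "degree Q = degree p"
    using arg_cong[OF Q, of degree] q(1) by simp
  hence leadQ: "lead_coeff Q = q"
    using arg_cong[OF Q, of "\<lambda>r. coeff r (degree p)"] assms by simp
  hence "Q \<noteq> 0" using q(1) by auto
  have QP: "Q = Polynomial.smult (content Q) P" by (simp add: P_def)
  have "\<bar>content Q\<bar> = content Q" using normalize_content[of Q] by (simp only: normalize_int_def)
  with \<open>Q \<noteq> 0\<close> have c: "content Q > 0" by (metis abs_of_nonneg abs_ge_zero content_eq_zero_iff le_less)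
  have qa: "q = content Q * a"
    using leadQ QP by (metis a_def lead_coeff_smult)
  have "of_int_poly P = Polynomial.smult (of_int a) p"
  proof -
    have "Polynomial.smult (of_int (content Q)) (of_int_poly P :: rat poly) = of_int_poly Q"
      using arg_cong[OF QP, of "of_int_poly :: int poly \<Rightarrow> rat poly"] by (simp add: hom_distribs)
    also have "\<dots> = Polynomial.smult (of_int (content Q)) (Polynomial.smult (of_int a) p)"
      unfolding Q by (subst qa) simp
    finally show ?thesis using \<open>Q \<noteq> 0\<close> by (auto simp: poly_eq_iff)
  qed
  moreover have "content P = 1" using \<open>Q \<noteq> 0\<close> by (simp add: P_def)
  moreover have "a > 0" using qa q(1) c by (simp add: zero_less_mult_iff)
  ultimately show ?thesis by blast
qed

text \<open>Gauss's lemma: contents multiply and a monic polynomial has content 1, so the positive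
  multipliers \<open>a\<close> and \<open>b\<close> of the two factors satisfy
  \<open>a * b = 1\<close>.\<close>

lemma monic_factor_of_int_poly:
  fixes p h :: "rat poly" and f :: "int poly"
  assumes "of_int_poly f = p * h" "lead_coeff f = 1" "lead_coeff p = 1"
  shows "\<exists>P. p = of_int_poly P"
proof -
  have "lead_coeff (of_int_poly f :: rat poly) = lead_coeff f"
    by simp
  hence h: "lead_coeff h = 1"
    using assms by (simp add: lead_coeff_mult)
  obtain a P where P: "a > 0" "content P = 1" "of_int_poly P = Polynomial.smult (of_int a) p"
    using ex_primitive_int_multiple[OF assms(3)] by blast
  obtain b H where H: "b > 0" "content H = 1" "of_int_poly H = Polynomial.smult (of_int b) h"
    using ex_primitive_int_multiple[OF h] by blast
  have "of_int_poly (P * H) = (of_int_poly (Polynomial.smult (a * b) f) :: rat poly)"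
    by (simp add: hom_distribs P H assms(1) mult.commute)
  hence eq: "P * H = Polynomial.smult (a * b) f" by (simp only: of_int_poly_hom.eq_iff)
  have "content f dvd lead_coeff f" by (rule content_dvd_coeff)
  hence "content f = 1" using assms(2)
    by (metis is_unit_content_iff)
  hence "1 = a * b" using arg_cong[OF eq, of content] P H by (simp add: content_mult)
  hence "a = 1" using P(1) H(1) by (metis pos_zmult_eq_1_iff)
  thus ?thesis using P(3) by (intro exI[of _ P]) simp
qed

text \<open>The irreducible \<open>p\<close> divides the monic integer polynomial vanishing at
  \<open>x\<close>, since otherwise a Bezout identity evaluated at \<open>x\<close> would read 0 =
  1.\<close>

lemma min_poly_algebraic_int:
  assumes "algebraic_int x" "is_min_poly p x"
  shows "\<exists>P. p = of_int_poly P"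
proof -
  interpret h: map_poly_inj_idom_hom "of_rat :: rat \<Rightarrow> real" ..
  obtain f :: "int poly" where f: "poly (of_int_poly f) x = 0" "lead_coeff f = 1"
    using assms(1) unfolding algebraic_int_altdef_ipoly by auto
  define F where "F = (of_int_poly f :: rat poly)"
  have F: "poly (map_poly of_rat F) x = 0"
    using f(1) by (simp add: F_def map_poly_map_poly o_def)
  have "p dvd F"
  proof (rule ccontr)
    assume "\<not> p dvd F"
    moreover have "prime_elem p"
      using assms(2) by (simp add: is_min_poly_def irreducible_imp_prime_elem)
    ultimately have "coprime p F" by (rule prime_elem_imp_coprime[rotated])
    hence "fst (bezout_coefficients p F) * p + snd (bezout_coefficients p F) * F = 1"
      by (simp add: bezout_coefficients_fst_snd)
    hence "poly (map_poly of_rat (fst (bezout_coefficients p F) * p + snd (bezout_coefficients p F) * F)) x = (1::real)"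
      by simp
    thus False using F assms(2) by (simp add: is_min_poly_def hom_distribs)
  qed
  then obtain h where "F = p * h" by (elim dvdE)
  thus ?thesis using monic_factor_of_int_poly[of f p h] f(2) assms(2) by (simp add: F_def is_min_poly_def)
qed

section \<open>Simultaneous approximation modulo 1, uniform in a shift\<close>

text \<open>
  Kronecker's theorem provides one multiplier for each of the finitely many points of a grid of the torus;
  the shift \<open>b\<close> is absorbed by moving to a nearby grid point, which makes the bound \<open>L\<close> uniform in \<open>b\<close>.
\<close>

lemma kronecker_relatively_dense:
  fixes \<theta> a :: "nat \<Rightarrow> real"
  assumes indep: "\<And>c c0. (\<Sum>k<n. of_int (c k) * \<theta> k) + of_int c0 = 0 \<Longrightarrow> \<forall>k<n. c k = (0::int)"
    and "\<eta> > 0"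
  shows "\<exists>L::real. \<forall>b. \<exists>t::int. \<bar>of_int t\<bar> \<le> L \<and> (\<forall>k<n. \<exists>m::int. \<bar>b k + of_int t * \<theta> k - a k - of_int m\<bar> < \<eta>)"
proof -
  \<comment> \<open>The library form of Kronecker's theorem wants 1 as the last member of the
    independent family.\<close>
  define \<theta>' where "\<theta>' = \<theta>(n := 1)"
  have "inj_on \<theta>' {..n}"
  proof (rule linorder_inj_onI)
    fix i j assume ij: "i < j" "i \<in> {..n}" "j \<in> {..n}"
    show "\<theta>' i \<noteq> \<theta>' j"
    proof
      assume eq: "\<theta>' i = \<theta>' j"
      \<comment> \<open>This encodes the relation \<open>\<theta> i - \<theta> j = 0\<close>; for
        \<open>j = n\<close> the second term moves into the constant.\<close>
      define c where "c k = (if k = i then 1 else if k = j then - 1 else (0::int))" for k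
      have "(\<Sum>k<n. of_int (c k) * \<theta> k) = (\<Sum>k<n. (if k = i then \<theta> k else 0) - (if k = j then \<theta> k else 0))"
        using ij by (intro sum.cong) (auto simp: c_def)
      also have "\<dots> = \<theta> i - (if j < n then \<theta> j else 0)"
        using ij by (simp add: sum_subtractf)
      finally have "(\<Sum>k<n. of_int (c k) * \<theta> k) + of_int (if j = n then - 1 else 0) = 0"
        using eq ij by (auto simp: \<theta>'_def split: if_splits)
      from indep[OF this, rule_format, of i] show False using ij by (simp add: c_def)
    qed
  qed auto
  interpret Modules.module "\<lambda>r x. real_of_int r * x"
    by (simp add: Modules.module.intro distrib_left mult.commute)
  have "independent (\<theta>' ` {..n})"
  proof (subst dependent_finite)
    have "u x = 0" if u: "(\<Sum>v\<in>\<theta>' ` {..n}. real_of_int (u v) * v) = 0" and x: "x \<in> \<theta>' ` {..n}" for u x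
    proof -
      have "(\<Sum>k\<le>n. real_of_int (u (\<theta>' k)) * \<theta>' k) = 0"
        using u sum.reindex[OF \<open>inj_on \<theta>' {..n}\<close>, of "\<lambda>v. real_of_int (u v) * v"] by simp
      hence eq: "(\<Sum>k<n. real_of_int (u (\<theta> k)) * \<theta> k) + real_of_int (u 1) = 0"
        by (simp add: lessThan_Suc_atMost[symmetric] \<theta>'_def)
      from indep[of "\<lambda>k. u (\<theta> k)", OF eq] have *: "\<forall>k<n. u (\<theta> k) = 0" .
      with eq have "u 1 = 0" by simp
      with * x show ?thesis by (auto simp: \<theta>'_def le_less)
    qed
    thus "\<not> (\<exists>u. (\<exists>v\<in>\<theta>' ` {..n}. u v \<noteq> 0) \<and> (\<Sum>v\<in>\<theta>' ` {..n}. real_of_int (u v) * v) = 0)" by blast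
  qed simp
  note kronecker = Kronecker_thm_2[OF this \<open>inj_on \<theta>' {..n}\<close>, of "\<eta> / 2"]
  obtain N :: nat where N: "inverse (real (Suc N)) < \<eta> / 2"
    using reals_Archimedean[of "\<eta> / 2"] \<open>\<eta> > 0\<close> by auto
  define K where "K = real (Suc N)"
  have K: "K > 0" "1 / K < \<eta> / 2" using N by (auto simp: K_def field_simps)
  define G where "G = {..<n} \<rightarrow>\<^sub>E {0..<Suc N}"
  have "finite G" unfolding G_def by (intro finite_PiE) auto
  have "\<exists>t::int. \<forall>k<n. \<exists>m::int. \<bar>of_int t * \<theta> k - of_int m - real (g k) / K\<bar> < \<eta> / 2" for g
  proof -
    obtain t m where "\<And>k. k < n \<Longrightarrow> \<bar>of_int t * \<theta>' k - of_int (m k) - real (g k) / K\<bar> < \<eta> / 2"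
      using kronecker[of "\<lambda>k. real (g k) / K"] \<open>\<eta> > 0\<close> by (auto simp: \<theta>'_def)
    thus ?thesis by (intro exI[of _ t] allI impI exI[of _ "m _"]) (auto simp: \<theta>'_def)
  qed
  then obtain t :: "(nat \<Rightarrow> nat) \<Rightarrow> int"
    where t: "\<And>g k. k < n \<Longrightarrow> \<exists>m::int. \<bar>of_int (t g) * \<theta> k - of_int m - real (g k) / K\<bar> < \<eta> / 2"
    by metis
  \<comment> \<open>The sum dominates the multiplier of every grid point.\<close>
  define L where "L = real_of_int (\<Sum>g\<in>G. \<bar>t g\<bar>)"
  have "\<exists>t::int. \<bar>of_int t\<bar> \<le> L \<and> (\<forall>k<n. \<exists>m::int. \<bar>b k + of_int t * \<theta> k - a k - of_int m\<bar> < \<eta>)" for b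
  proof -
    \<comment> \<open>The wanted displacement modulo 1, rounded down to the grid of mesh
      \<open>1 / K\<close>.\<close>
    define g where "g = restrict (\<lambda>k. nat \<lfloor>frac (a k - b k) * K\<rfloor>) {..<n}"
    have grid: "g k < Suc N" "\<bar>real (g k) / K - frac (a k - b k)\<bar> < \<eta> / 2" if "k < n" for k
    proof -
      let ?f = "frac (a k - b k)"
      have f: "0 \<le> ?f * K" "?f * K < K" using K(1) frac_lt_1[of "a k - b k"] by auto
      have gk: "real (g k) = of_int \<lfloor>?f * K\<rfloor>" using that f by (simp add: g_def)
      have "real (g k) < K" using f(2) gk of_int_floor_le[of "?f * K"] by linarith
      thus "g k < Suc N" by (simp only: K_def of_nat_less_iff)
      have "\<bar>real (g k) - ?f * K\<bar> \<le> 1" unfolding gk by linarith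
      hence "\<bar>real (g k) / K - ?f\<bar> \<le> 1 / K"
        using K(1) by (simp add: field_simps abs_le_iff)
      with K(2) show "\<bar>real (g k) / K - ?f\<bar> < \<eta> / 2" by linarith
    qed
    have "g \<in> G" unfolding G_def g_def[symmetric]
      by (intro PiE_I) (use grid in \<open>auto simp: g_def\<close>)
    hence "\<bar>t g\<bar> \<le> (\<Sum>g\<in>G. \<bar>t g\<bar>)" using \<open>finite G\<close> by (intro member_le_sum) auto
    hence "\<bar>real_of_int (t g)\<bar> \<le> L" unfolding L_def by (simp only: of_int_abs[symmetric] of_int_le_iff)
    moreover have "\<exists>m::int. \<bar>b k + of_int (t g) * \<theta> k - a k - of_int m\<bar> < \<eta>" if k: "k < n" for k
    proof -
      obtain m :: int where "\<bar>of_int (t g) * \<theta> k - of_int m - real (g k) / K\<bar> < \<eta> / 2" using t[OF k] by blast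
      moreover have "b k + of_int (t g) * \<theta> k - a k - of_int (m - \<lfloor>a k - b k\<rfloor>)
          = (of_int (t g) * \<theta> k - of_int m - real (g k) / K) + (real (g k) / K - frac (a k - b k))"
        by (simp add: frac_def)
      ultimately have "\<bar>b k + of_int (t g) * \<theta> k - a k - of_int (m - \<lfloor>a k - b k\<rfloor>)\<bar> < \<eta>"
        using grid(2)[OF k] abs_triangle_ineq[of "of_int (t g) * \<theta> k - of_int m - real (g k) / K" "real (g k) / K - frac (a k - b k)"]
        by linarith
      thus ?thesis by blast
    qed
    ultimately show ?thesis by blast
  qed
  thus ?thesis by blast
qed

section \<open>Evaluation of rational polynomials in several variables\<close>

text \<open>
  \<open>eval_rat_mpoly\<close> is the expression in the definition of algebraic independence. Being a ring
  homomorphism, it lets a polynomial relation at an algebraically independent point be transported to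
  every other point, so that no polynomial has to be written down.
\<close>

definition eval_rat_mpoly :: "('i::finite \<Rightarrow> real) \<Rightarrow> (('i \<Rightarrow>\<^sub>0 nat) \<Rightarrow>\<^sub>0 rat) \<Rightarrow> real" where
  "eval_rat_mpoly x p = (\<Sum>m\<in>Poly_Mapping.keys p.
      of_rat (Poly_Mapping.lookup p m) * (\<Prod>i\<in>UNIV. x i ^ Poly_Mapping.lookup m i))"

lemma eval_rat_mpoly_superset:
  assumes "finite S" "Poly_Mapping.keys p \<subseteq> S"
  shows "eval_rat_mpoly x p = (\<Sum>m\<in>S.
      of_rat (Poly_Mapping.lookup p m) * (\<Prod>i\<in>UNIV. x i ^ Poly_Mapping.lookup m i))"
  unfolding eval_rat_mpoly_def using assms
  by (intro sum.mono_neutral_left) (auto simp: in_keys_iff)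

lemma eval_rat_mpoly_0 [simp]: "eval_rat_mpoly x 0 = 0"
  by (simp add: eval_rat_mpoly_def)

lemma eval_rat_mpoly_add: "eval_rat_mpoly x (p + q) = eval_rat_mpoly x p + eval_rat_mpoly x q"
proof -
  let ?S = "Poly_Mapping.keys p \<union> Poly_Mapping.keys q"
  have "eval_rat_mpoly x (p + q) = (\<Sum>m\<in>?S.
      of_rat (Poly_Mapping.lookup (p + q) m) * (\<Prod>i\<in>UNIV. x i ^ Poly_Mapping.lookup m i))"
    by (rule eval_rat_mpoly_superset) (auto simp: Poly_Mapping.keys_add)
  also have "\<dots> = eval_rat_mpoly x p + eval_rat_mpoly x q"
    by (simp add: eval_rat_mpoly_superset[of ?S p] eval_rat_mpoly_superset[of ?S q]
        lookup_add of_rat_add distrib_right sum.distrib)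
  finally show ?thesis .
qed

lemma eval_rat_mpoly_sum: "eval_rat_mpoly x (\<Sum>i\<in>I. f i) = (\<Sum>i\<in>I. eval_rat_mpoly x (f i))"
  by (induction I rule: infinite_finite_induct) (auto simp: eval_rat_mpoly_add)

lemma eval_rat_mpoly_single:
  "eval_rat_mpoly x (Poly_Mapping.single m c) = of_rat c * (\<Prod>i\<in>UNIV. x i ^ Poly_Mapping.lookup m i)"
  by (subst eval_rat_mpoly_superset[of "{m}"]) auto

lemma poly_mapping_eq_sum_single:
  "p = (\<Sum>m\<in>Poly_Mapping.keys p. Poly_Mapping.single m (Poly_Mapping.lookup p m))"
  by (rule poly_mapping_eqI)
    (auto simp: lookup_sum lookup_single when_def in_keys_iff sum.delta[OF finite_keys])

lemma eval_rat_mpoly_mult: "eval_rat_mpoly x (p * q) = eval_rat_mpoly x p * eval_rat_mpoly x q"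
proof -
  let ?f = "\<lambda>p m. Poly_Mapping.single m (Poly_Mapping.lookup p m)"
  have "p * q = (\<Sum>m\<in>Poly_Mapping.keys p. \<Sum>l\<in>Poly_Mapping.keys q. ?f p m * ?f q l)"
    using arg_cong2[where f = "(*)", OF poly_mapping_eq_sum_single[of p] poly_mapping_eq_sum_single[of q]]
    by (simp only: sum_product)
  also have "eval_rat_mpoly x \<dots> = (\<Sum>m\<in>Poly_Mapping.keys p. \<Sum>l\<in>Poly_Mapping.keys q.
      eval_rat_mpoly x (?f p m) * eval_rat_mpoly x (?f q l))"
    by (simp add: eval_rat_mpoly_sum Poly_Mapping.mult_single eval_rat_mpoly_single lookup_add power_add
        prod.distrib of_rat_mult mult_ac)
  also have "\<dots> = eval_rat_mpoly x p * eval_rat_mpoly x q"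
    unfolding eval_rat_mpoly_single unfolding eval_rat_mpoly_def sum_product ..
  finally show ?thesis .
qed

definition rat_mpoly_fun :: "(real ^ 'i::finite \<Rightarrow> real) \<Rightarrow> bool" where
  "rat_mpoly_fun f \<longleftrightarrow> (\<exists>p. \<forall>v. f v = eval_rat_mpoly (\<lambda>i. v $ i) p)"

lemma rat_mpoly_fun_const: "rat_mpoly_fun (\<lambda>v. of_rat c)"
  unfolding rat_mpoly_fun_def
  by (intro exI[of _ "Poly_Mapping.single 0 c"]) (simp add: eval_rat_mpoly_single)

lemma rat_mpoly_fun_of_int: "rat_mpoly_fun (\<lambda>v. of_int c)"
  using rat_mpoly_fun_const[of "of_int c"] by simp

lemma rat_mpoly_fun_nth: "rat_mpoly_fun (\<lambda>v. v $ i)"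
proof -
  have "v $ i = eval_rat_mpoly (\<lambda>i. v $ i) (Poly_Mapping.single (Poly_Mapping.single i 1) 1)" for v :: "real ^ 'a"
  proof -
    have "(\<Prod>j\<in>UNIV. v $ j ^ Poly_Mapping.lookup (Poly_Mapping.single i 1) j) = (\<Prod>j\<in>UNIV. if j = i then v $ j else 1)"
      by (intro prod.cong) (auto simp: lookup_single)
    thus ?thesis by (simp add: eval_rat_mpoly_single)
  qed
  thus ?thesis unfolding rat_mpoly_fun_def by blast
qed

lemma rat_mpoly_fun_add:
  assumes "rat_mpoly_fun f" "rat_mpoly_fun g"
  shows "rat_mpoly_fun (\<lambda>v. f v + g v)"
  using assms unfolding rat_mpoly_fun_def by (metis eval_rat_mpoly_add)

lemma rat_mpoly_fun_mult:
  assumes "rat_mpoly_fun f" "rat_mpoly_fun g"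
  shows "rat_mpoly_fun (\<lambda>v. f v * g v)"
  using assms unfolding rat_mpoly_fun_def by (metis eval_rat_mpoly_mult)

lemma rat_mpoly_fun_sum:
  assumes "\<And>i. i \<in> I \<Longrightarrow> rat_mpoly_fun (f i)"
  shows "rat_mpoly_fun (\<lambda>v. \<Sum>i\<in>I. f i v)"
  using assms
proof (induction I rule: infinite_finite_induct)
  case (insert x F)
  then show ?case by (simp add: rat_mpoly_fun_add)
qed (use rat_mpoly_fun_of_int[of 0] in auto)

lemma alg_independent_rat_mpoly_fun:
  assumes "alg_independent_over_rat (\<lambda>i. r $ i)" "rat_mpoly_fun f" "f r = 0"
  shows "f v = 0"
proof -
  obtain p where p: "\<And>v. f v = eval_rat_mpoly (\<lambda>i. v $ i) p" using assms(2) unfolding rat_mpoly_fun_def by blast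
  have "p = 0"
    using assms(1,3) p[of r] unfolding alg_independent_over_rat_def eval_rat_mpoly_def by auto
  thus ?thesis by (simp add: p)
qed


section \<open>Small fractional parts along orbits\<close>

context contracting_srs
begin

text \<open>For a common denominator \<open>q\<close>, each step costs one factor: if
  \<open>q ^ Suc n\<close> divides \<open>z\<close>, then \<open>r \<bullet> z\<close> is an integer
  divisible by \<open>q ^ n\<close>, and so is every coordinate of \<open>\<tau> z\<close>. Thus on
  multiples of \<open>q ^ n\<close> the first \<open>n\<close> fractional parts vanish.\<close>

lemma small_fracs_dense_rational:
  assumes "\<forall>i. r $ i \<in> \<rat>" "\<delta> > 0"
  shows "small_fracs_dense n \<delta>"
proof -
  obtain q :: int where q: "q > 0" "\<forall>x\<in>range (($) r). of_int q * x \<in> \<int>"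
    using ex_common_denominator[of "range (($) r)"] assms(1) by auto
  hence "\<exists>w. of_int q * r $ i = of_int w" for i by (auto elim: Ints_cases)
  then obtain w :: "'n \<Rightarrow> int" where w: "\<And>i. of_int q * r $ i = of_int (w i)" by metis
  have zero: "\<forall>k<n. frac (r \<bullet> real_vec ((\<tau> ^^ k) z)) = 0" if "\<forall>i. q ^ n dvd z $ i" for n z
    using that
  proof (induction n arbitrary: z)
    case (Suc n)
    then obtain u where u: "\<And>i. z $ i = q ^ Suc n * u i" unfolding dvd_def by metis
    define s where "s = (\<Sum>i\<in>UNIV. q ^ n * (w i * u i))"
    have "r $ i * real_of_int (z $ i) = (of_int q * r $ i) * of_int (q ^ n * u i)" for i
      by (simp add: u)
    hence s: "r \<bullet> real_vec z = of_int s"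
      by (simp add: inner_vec_def s_def w mult_ac)
    have "q ^ n dvd \<tau> z $ i" for i
    proof -
      have "q ^ n dvd s" unfolding s_def by (intro dvd_sum) simp
      moreover have "q ^ n dvd z $ j" for j by (simp add: u)
      ultimately show ?thesis by (simp add: srs_map_nth s)
    qed
    with Suc.IH have IH: "\<forall>k<n. frac (r \<bullet> real_vec ((\<tau> ^^ k) (\<tau> z))) = 0" by blast
    show ?case
    proof (intro allI impI)
      fix k assume "k < Suc n"
      thus "frac (r \<bullet> real_vec ((\<tau> ^^ k) z)) = 0"
        using IH s by (cases k) (auto simp: funpow_swap1)
    qed
  qed simp
  have "\<exists>z. norm (real_vec (z - z0)) \<le> CARD('n) * of_int (q ^ n) \<and>
      (\<forall>k<n. frac (r \<bullet> real_vec ((\<tau> ^^ k) z)) < \<delta>)" for z0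
  proof (intro exI conjI)
    define z where "z = (\<chi> i. q ^ n * (z0 $ i div q ^ n))"
    have "\<bar>real_vec (z - z0) $ i\<bar> \<le> of_int (q ^ n)" for i
    proof -
      have "real_vec (z - z0) $ i = - of_int (z0 $ i mod q ^ n)"
        by (simp add: z_def minus_mult_div_eq_mod[symmetric])
      moreover have "0 \<le> z0 $ i mod q ^ n" "z0 $ i mod q ^ n < q ^ n" using q(1) by auto
      hence "0 \<le> real_of_int (z0 $ i mod q ^ n)" "real_of_int (z0 $ i mod q ^ n) \<le> of_int (q ^ n)"
        by (simp_all only: of_int_0_le_iff of_int_le_iff less_imp_le)
      ultimately show ?thesis by linarith
    qed
    hence "(\<Sum>i\<in>UNIV. \<bar>real_vec (z - z0) $ i\<bar>) \<le> (\<Sum>i\<in>(UNIV :: 'n set). of_int (q ^ n))"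
      by (intro sum_mono) auto
    thus "norm (real_vec (z - z0)) \<le> CARD('n) * of_int (q ^ n)"
      using norm_le_l1_cart[of "real_vec (z - z0)"] by simp
    have "\<forall>i. q ^ n dvd z $ i" by (simp add: z_def)
    from zero[OF this] show "\<forall>k<n. frac (r \<bullet> real_vec ((\<tau> ^^ k) z)) < \<delta>"
      using assms(2) by metis
  qed
  thus ?thesis unfolding small_fracs_dense_def by blast
qed

section \<open>Pisot parameters\<close>

lemma real_vec_axis: "real_vec (axis i t) = of_int t *\<^sub>R axis i 1"
  by (auto simp: Finite_Cartesian_Product.vec_eq_iff axis_def)

text \<open>Aiming at the centre of the window from 0 to \<open>2 * c\<close> keeps \<open>x\<close>
  above the integer \<open>m\<close>, so the fractional part cannot wrap around to near 1.\<close>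

lemma frac_less_if_near:
  assumes "\<bar>x - c - of_int m\<bar> < c"
  shows "frac (x::real) < 2 * c"
proof -
  have "m \<le> \<lfloor>x\<rfloor>" using assms by (simp add: le_floor_iff)
  hence "real_of_int m \<le> of_int \<lfloor>x\<rfloor>" by simp
  thus ?thesis using assms unfolding frac_def by linarith
qed

text \<open>As long as \<open>\<beta> ^ k * frac (r \<bullet> z)\<close> is below 1, it is the
  fractional part after \<open>k\<close> steps. So only the first one must be small, and this is
  achieved by moving a single coordinate with irrational coefficient.\<close>

lemma small_fracs_dense_expanding:
  assumes \<beta>: "\<beta> > 1"
    and step: "\<And>z. \<exists>m::int. r \<bullet> real_vec (\<tau> z) = \<beta> * frac (r \<bullet> real_vec z) + of_int m"
    and irrat: "r $ i \<notin> \<rat>" and "\<delta> > 0"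
  shows "small_fracs_dense n \<delta>"
proof -
  define \<epsilon> where "\<epsilon> = min \<delta> 1 / \<beta> ^ n"
  have \<epsilon>: "\<epsilon> > 0" using \<beta> \<open>\<delta> > 0\<close> by (simp add: \<epsilon>_def)
  have indep: "\<forall>k<1. c k = 0" if "(\<Sum>k<1. of_int (c k) * r $ i) + of_int c0 = 0" for c :: "nat \<Rightarrow> int" and c0
  proof (rule ccontr)
    assume "\<not> (\<forall>k<1. c k = 0)"
    hence "r $ i = - of_int c0 / of_int (c 0)" using that by (simp add: field_simps add_eq_0_iff)
    hence "r $ i \<in> \<rat>" by simp
    with irrat show False by simp
  qed
  obtain L :: real where L: "\<And>b. \<exists>t::int. \<bar>of_int t\<bar> \<le> L \<and>
      (\<forall>k<1::nat. \<exists>m::int. \<bar>b k + of_int t * r $ i - \<epsilon> / 2 - of_int m\<bar> < \<epsilon> / 2)"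
  proof -
    have "\<exists>L::real. \<forall>b. \<exists>t::int. \<bar>of_int t\<bar> \<le> L \<and>
      (\<forall>k<1::nat. \<exists>m::int. \<bar>b k + of_int t * r $ i - \<epsilon> / 2 - of_int m\<bar> < \<epsilon> / 2)"
      using indep \<epsilon> by (intro kronecker_relatively_dense) simp_all
    thus ?thesis using that by blast
  qed
  have "\<exists>z. norm (real_vec (z - z0)) \<le> L \<and> (\<forall>k<n. frac (r \<bullet> real_vec ((\<tau> ^^ k) z)) < \<delta>)" for z0
  proof -
    obtain t m :: int where t: "\<bar>of_int t\<bar> \<le> L"
        and m: "\<bar>r \<bullet> real_vec z0 + of_int t * r $ i - \<epsilon> / 2 - of_int m\<bar> < \<epsilon> / 2"
      using L[of "\<lambda>_. r \<bullet> real_vec z0"] by auto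
    define z where "z = z0 + axis i t"
    have "r \<bullet> real_vec z = r \<bullet> real_vec z0 + of_int t * r $ i"
      by (simp add: z_def real_vec_axis inner_add_right inner_axis)
    hence small: "frac (r \<bullet> real_vec z) < \<epsilon>"
      using frac_less_if_near[of "r \<bullet> real_vec z" "\<epsilon> / 2" m] m by simp
    have \<beta>_pow: "\<beta> ^ k * frac (r \<bullet> real_vec z) < min \<delta> 1" if "k \<le> n" for k
    proof -
      have "\<beta> ^ k * frac (r \<bullet> real_vec z) \<le> \<beta> ^ n * frac (r \<bullet> real_vec z)"
        using \<beta> that by (intro mult_right_mono power_increasing) auto
      also have "\<dots> < \<beta> ^ n * \<epsilon>" using \<beta> small by (intro mult_strict_left_mono) auto
      also have "\<dots> = min \<delta> 1" using \<beta> by (simp add: \<epsilon>_def)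
      finally show ?thesis .
    qed
    have orbit: "k \<le> n \<Longrightarrow> frac (r \<bullet> real_vec ((\<tau> ^^ k) z)) = \<beta> ^ k * frac (r \<bullet> real_vec z)" for k
    proof (induction k)
      case (Suc k)
      obtain m where "r \<bullet> real_vec ((\<tau> ^^ Suc k) z) = \<beta> ^ Suc k * frac (r \<bullet> real_vec z) + of_int m"
        using step[of "(\<tau> ^^ k) z"] Suc by (auto simp: mult.assoc)
      thus ?case using \<beta>_pow[OF Suc.prems] \<beta> by (simp add: frac_unique_iff del: funpow.simps power_Suc)
    qed simp
    have "\<forall>k<n. frac (r \<bullet> real_vec ((\<tau> ^^ k) z)) < \<delta>"
      using orbit \<beta>_pow by simp
    thus ?thesis using t by (intro exI[of _ z]) (simp add: z_def real_vec_axis del: real_vec_add)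
  qed
  thus ?thesis unfolding small_fracs_dense_def by blast
qed

text \<open>
  The coefficients of the integer polynomial are \<open>r\<^sub>k\<^sub>-\<^sub>1 - \<beta> * r\<^sub>k\<close>, so up to integers
  the functional \<open>z \<mapsto> r \<bullet> z\<close> conjugates \<open>\<tau>\<close> to the \<open>\<beta>\<close>-transformation.
\<close>

lemma pisot_step:
  assumes p: "map_poly of_rat p = [:- \<beta>, 1:] * (monom 1 CARD('n) + (\<Sum>k<CARD('n). monom (r $ ix k) k))"
    and P: "p = of_int_poly P"
  shows "\<exists>m::int. r \<bullet> real_vec (\<tau> z) = \<beta> * frac (r \<bullet> real_vec z) + of_int m"
proof -
  let ?d = "CARD('n)"
  define q where "q = monom 1 ?d + (\<Sum>k<?d. monom (r $ ix k) k)"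
  have q: "coeff q k = r $ ix k" if "k < ?d" for k
    using that by (simp add: q_def coeff_sum)
  have q_d: "coeff q ?d = 1"
    by (simp add: q_def coeff_sum)
  have "of_int_poly P = pCons 0 q - Polynomial.smult \<beta> q"
    using p unfolding P q_def[symmetric] by (simp add: map_poly_map_poly o_def)
  hence P_coeff: "of_int (coeff P k) = coeff (pCons 0 q) k - \<beta> * coeff q k" for k
    by (metis coeff_diff coeff_smult of_int_hom.coeff_map_poly_hom)
  \<comment> \<open>The coordinates of \<open>z\<close> followed by the new one: \<open>z\<close> is
    the window 0 to \<open>d - 1\<close>, \<open>\<tau> z\<close> the window 1 to
    \<open>d\<close>.\<close>
  define y where "y k = (if k < ?d then z $ ix k else - \<lfloor>r \<bullet> real_vec z\<rfloor>)" for k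
  have y: "\<tau> z $ ix k = y (Suc k)" if "k < ?d" for k
    using that by (simp add: srs_map_nth pos_ix y_def)
  have "r \<bullet> real_vec (\<tau> z) = (\<Sum>k<?d. coeff q k * of_int (y (Suc k)))"
    by (simp add: inner_vec_def sum_UNIV_ix q y)
  also have "\<dots> = (\<Sum>k<?d. \<beta> * (coeff q (Suc k) * of_int (y (Suc k))) + of_int (coeff P (Suc k) * y (Suc k)))"
    by (intro sum.cong) (auto simp: P_coeff algebra_simps)
  also have "\<dots> = \<beta> * (\<Sum>k<?d. coeff q (Suc k) * of_int (y (Suc k))) + of_int (\<Sum>k<?d. coeff P (Suc k) * y (Suc k))"
    by (simp add: sum.distrib sum_distrib_left)
  also have "(\<Sum>k<?d. coeff q (Suc k) * of_int (y (Suc k))) = (\<Sum>k<Suc ?d. coeff q k * of_int (y k)) - coeff q 0 * of_int (y 0)"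
    by (subst sum.lessThan_Suc_shift) simp
  \<comment> \<open>As \<open>q\<close> is monic, the extra term is the negated floor, which leaves
    the fractional part.\<close>
  also have "(\<Sum>k<Suc ?d. coeff q k * of_int (y k)) = r \<bullet> real_vec z - of_int \<lfloor>r \<bullet> real_vec z\<rfloor>"
    by (simp add: inner_vec_def sum_UNIV_ix q q_d y_def)
  also have "\<dots> = frac (r \<bullet> real_vec z)" by (simp add: frac_def)
  also have "\<beta> * (frac (r \<bullet> real_vec z) - coeff q 0 * of_int (y 0)) + of_int (\<Sum>k<?d. coeff P (Suc k) * y (Suc k))
      = \<beta> * frac (r \<bullet> real_vec z) + of_int (coeff P 0 * y 0 + (\<Sum>k<?d. coeff P (Suc k) * y (Suc k)))"
    using P_coeff[of 0] by (simp add: algebra_simps)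
  finally show ?thesis by blast
qed

text \<open>Adding \<open>t\<close> times the last unit vector moves
  \<open>r \<bullet> (M ^^ k) z\<close> by \<open>t * \<theta> k\<close>, so Kronecker's theorem
  places all these numbers in given windows modulo 1. Induction on \<open>k\<close> then controls
  the deviation of \<open>\<tau> ^^ k\<close> from \<open>M ^^ k\<close>.\<close>

lemma small_fracs_dense_independent:
  assumes indep: "\<And>c c0. (\<Sum>k<n. of_int (c k) * (r \<bullet> (M ^^ k) last_axis)) + of_int c0 = 0 \<Longrightarrow> \<forall>k<n. c k = (0::int)"
    and "\<delta> > 0"
  shows "small_fracs_dense n \<delta>"
proof -
  define \<kappa> where "\<kappa> = min 1 (1 / (4 * (norm r * R + 1)))"
  have pos: "4 * (norm r * R + 1) > 0" using R_pos by (simp add: add_nonneg_pos)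
  have \<kappa>: "0 < \<kappa>" "\<kappa> \<le> 1" using pos by (auto simp: \<kappa>_def)
  have "norm r * R * \<kappa> \<le> (norm r * R + 1) * (1 / (4 * (norm r * R + 1)))"
    using R_pos \<kappa> by (intro mult_mono) (auto simp: \<kappa>_def)
  also have "\<dots> = 1 / 4" using pos by simp
  finally have r\<kappa>: "norm r * R * \<kappa> \<le> 1 / 4" .
  \<comment> \<open>Before step \<open>k\<close>, fractional parts below \<open>\<kappa> * D k\<close> move \<open>r \<bullet> (\<tau> ^^ k) z\<close> away from
     \<open>r \<bullet> (M ^^ k) z\<close> by at most \<open>D k / 4\<close>; so the windows have to shrink geometrically backwards.\<close>
  define D where "D k = \<delta> * \<kappa> ^ (n - k)" for k
  have D_pos: "D k > 0" and D_le: "D k \<le> \<delta>" for k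
    using \<kappa> \<open>\<delta> > 0\<close> by (auto simp: D_def mult_left_le power_le_one)
  have D_Suc: "D j \<le> \<kappa> * D k" if "j < k" "k \<le> n" for j k
  proof -
    have "\<kappa> ^ (n - j) \<le> \<kappa> ^ Suc (n - k)" using \<kappa> that by (intro power_decreasing) auto
    thus ?thesis using \<open>\<delta> > 0\<close> by (simp add: D_def)
  qed
  define \<eta> where "\<eta> = \<delta> * \<kappa> ^ n / 4"
  have "\<eta> > 0" using \<kappa> \<open>\<delta> > 0\<close> by (simp add: \<eta>_def)
  have \<eta>: "\<eta> \<le> D k / 4" for k
  proof -
    have "\<kappa> ^ n \<le> \<kappa> ^ (n - k)" using \<kappa> by (intro power_decreasing) auto
    thus ?thesis using \<open>\<delta> > 0\<close> by (simp add: D_def \<eta>_def)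
  qed
  define \<theta> where "\<theta> k = r \<bullet> (M ^^ k) last_axis" for k
  obtain L :: real where L: "\<And>b. \<exists>t::int. \<bar>of_int t\<bar> \<le> L \<and>
      (\<forall>k<n. \<exists>m::int. \<bar>b k + of_int t * \<theta> k - D k / 2 - of_int m\<bar> < \<eta>)"
  proof -
    have "\<exists>L::real. \<forall>b. \<exists>t::int. \<bar>of_int t\<bar> \<le> L \<and>
      (\<forall>k<n. \<exists>m::int. \<bar>b k + of_int t * \<theta> k - D k / 2 - of_int m\<bar> < \<eta>)"
      by (rule kronecker_relatively_dense[OF _ \<open>\<eta> > 0\<close>]) (rule indep, simp add: \<theta>_def)
    thus ?thesis using that by blast
  qed
  have "\<exists>z. norm (real_vec (z - z0)) \<le> L \<and> (\<forall>k<n. frac (r \<bullet> real_vec ((\<tau> ^^ k) z)) < \<delta>)" for z0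
  proof -
    obtain t :: int where t: "\<bar>of_int t\<bar> \<le> L"
        and near: "\<And>k. k < n \<Longrightarrow> \<exists>m::int. \<bar>r \<bullet> (M ^^ k) (real_vec z0) + of_int t * \<theta> k - D k / 2 - of_int m\<bar> < \<eta>"
      using L[of "\<lambda>k. r \<bullet> (M ^^ k) (real_vec z0)"] by blast
    define z where "z = z0 + axis (ix (CARD('n) - 1)) t"
    have "real_vec z = real_vec z0 + of_int t *\<^sub>R last_axis"
      by (simp add: z_def real_vec_axis last_axis_def)
    hence rM: "r \<bullet> (M ^^ k) (real_vec z) = r \<bullet> (M ^^ k) (real_vec z0) + of_int t * \<theta> k" for k
      by (simp add: M_pow_add M_pow_scale inner_add_right \<theta>_def)
    have small: "k < n \<Longrightarrow> frac (r \<bullet> real_vec ((\<tau> ^^ k) z)) < D k" for k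
    proof (induction k rule: less_induct)
      case (less k)
      obtain m :: int where m: "\<bar>r \<bullet> (M ^^ k) (real_vec z) - D k / 2 - of_int m\<bar> < \<eta>"
        using near[OF less.prems] unfolding rM by blast
      have "frac (r \<bullet> real_vec ((\<tau> ^^ j) z)) \<le> \<kappa> * D k" if "j < k" for j
        using less.IH[of j] D_Suc[of j k] that less.prems by simp
      hence "norm (real_vec ((\<tau> ^^ k) z) - (M ^^ k) (real_vec z)) \<le> R * (\<kappa> * D k)"
        using srs_map_pow_near_M_pow[of "\<kappa> * D k" k z 0] \<kappa> D_pos[of k] by simp
      hence "norm r * norm (real_vec ((\<tau> ^^ k) z) - (M ^^ k) (real_vec z)) \<le> norm r * (R * (\<kappa> * D k))"
        by (rule mult_left_mono) simp
      also have "\<dots> \<le> 1 / 4 * D k"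
        using mult_right_mono[OF r\<kappa>, of "D k"] D_pos[of k] by (simp add: mult_ac)
      finally have "\<bar>r \<bullet> (real_vec ((\<tau> ^^ k) z) - (M ^^ k) (real_vec z))\<bar> \<le> D k / 4"
        using Cauchy_Schwarz_ineq2[of r "real_vec ((\<tau> ^^ k) z) - (M ^^ k) (real_vec z)"] by linarith
      \<comment> \<open>Half of the radius \<open>D k / 2\<close> is spent on the deviation, the
        other half on \<open>\<eta>\<close>.\<close>
      hence "\<bar>r \<bullet> real_vec ((\<tau> ^^ k) z) - D k / 2 - of_int m\<bar> < D k / 2"
        using m \<eta>[of k] unfolding inner_diff_right by linarith
      from frac_less_if_near[OF this] show ?case by simp
    qed
    have "\<forall>k<n. frac (r \<bullet> real_vec ((\<tau> ^^ k) z)) < \<delta>"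
      using small D_le by (meson order_less_le_trans)
    thus ?thesis using t by (intro exI[of _ z]) (simp add: z_def real_vec_axis del: real_vec_add)
  qed
  thus ?thesis unfolding small_fracs_dense_def by blast
qed

end

section \<open>Algebraic independence and powers of the companion matrix\<close>

lemma inner_last_axis: "v \<bullet> last_axis = v $ ix (CARD('n) - 1)" for v :: "real ^ 'n::{finite,linorder}"
  by (simp add: last_axis_def inner_axis)

lemma companion_scaled_last_axis_funpow:
  fixes t :: real
  defines "e \<equiv> (last_axis :: real ^ 'n::{finite,linorder})"
  shows "((*v) (companion (t *\<^sub>R e)) ^^ k) e $ ix (CARD('n) - 1) = (- t) ^ k"
proof (induction k)
  case 0
  show ?case by (simp add: e_def last_axis_nth pos_ix)
next
  case (Suc k)
  thus ?case
    using inner_last_axis[of "((*v) (companion (t *\<^sub>R e)) ^^ k) e"]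
    by (simp add: companion_mult_nth pos_ix inner_commute e_def)
qed

lemma rat_mpoly_fun_companion_funpow:
  "rat_mpoly_fun (\<lambda>v :: real ^ 'n::{finite,linorder}. ((*v) (companion v) ^^ k) last_axis $ i)"
proof (induction k arbitrary: i)
  case 0
  show ?case
    using rat_mpoly_fun_of_int[of 0, where ?'a = 'n] rat_mpoly_fun_of_int[of 1, where ?'a = 'n]
    by (simp add: last_axis_nth)
next
  case (Suc k)
  show ?case
  proof (cases "Suc (pos i) < CARD('n)")
    case True
    thus ?thesis using Suc by (simp add: companion_mult_nth)
  next
    case False
    have "rat_mpoly_fun (\<lambda>v :: real ^ 'n::{finite,linorder}. of_int (- 1) * (\<Sum>j\<in>UNIV. v $ j * ((*v) (companion v) ^^ k) last_axis $ j))"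
      by (intro rat_mpoly_fun_mult rat_mpoly_fun_of_int rat_mpoly_fun_sum rat_mpoly_fun_nth Suc)
    thus ?thesis using False by (simp add: companion_mult_nth inner_vec_def)
  qed
qed

text \<open>The relation is polynomial in \<open>r\<close> with rational coefficients, hence an
  identity. Specialising \<open>r\<close> to multiples of \<open>last_axis\<close> turns it into a
  polynomial in one variable whose coefficients are, up to sign, the \<open>c k\<close> and
  \<open>c0\<close>.\<close>

lemma alg_independent_imp_independent:
  fixes r :: "real ^ 'n::{finite,linorder}" and c :: "nat \<Rightarrow> int"
  assumes alg: "alg_independent_over_rat (\<lambda>i. r $ i)"
    and zero: "(\<Sum>k<n. of_int (c k) * (r \<bullet> ((*v) (companion r) ^^ k) last_axis)) + of_int c0 = 0"
  shows "\<forall>k<n. c k = 0"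
proof -
  define f where "f v = (\<Sum>k<n. of_int (c k) * (v \<bullet> ((*v) (companion v) ^^ k) last_axis)) + of_int c0"
    for v :: "real ^ 'n::{finite,linorder}"
  have "rat_mpoly_fun f"
    unfolding f_def inner_vec_def inner_real_def
    by (intro rat_mpoly_fun_add rat_mpoly_fun_sum rat_mpoly_fun_mult rat_mpoly_fun_of_int
        rat_mpoly_fun_nth rat_mpoly_fun_companion_funpow)
  moreover have "f r = 0" using zero by (simp add: f_def)
  ultimately have f0: "f v = 0" for v by (rule alg_independent_rat_mpoly_fun[OF alg])
  \<comment> \<open>At the point \<open>(0, \<dots>, 0, t)\<close> the relation becomes a polynomial in \<open>t\<close>.\<close>
  define p where "p = (\<Sum>k<n. monom (of_int (c k) * (- 1) ^ k) (Suc k)) + [:real_of_int c0:]"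
  have "poly p t = f (t *\<^sub>R last_axis)" for t
  proof -
    have "t *\<^sub>R last_axis \<bullet> ((*v) (companion (t *\<^sub>R (last_axis :: real ^ 'n::{finite,linorder}))) ^^ k) last_axis
        = t * (- t) ^ k" for k
      by (simp only: inner_scaleR_left inner_commute[of last_axis] inner_last_axis
          companion_scaled_last_axis_funpow)
    hence "f (t *\<^sub>R last_axis) = (\<Sum>k<n. of_int (c k) * (t * (- t) ^ k)) + of_int c0"
      by (simp only: f_def)
    thus ?thesis by (simp add: p_def poly_sum poly_monom power_minus[of t] mult_ac)
  qed
  hence "p = 0" using f0 by (simp add: poly_all_0_iff_0[symmetric])
  have "c k = 0" if "k < n" for k
  proof -
    \<comment> \<open>The shift to degree \<open>Suc k\<close> keeps \<open>c 0\<close> apart from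
      the constant \<open>c0\<close>.\<close>
    have "coeff p (Suc k) = of_int (c k) * (- 1) ^ k"
      using that by (simp add: p_def coeff_sum)
    thus ?thesis using \<open>p = 0\<close> by simp
  qed
  thus ?thesis by blast
qed

theorem mainTheorem2:
  fixes r :: "real ^ 'n::{finite,linorder}"
  assumes "r $ ix 0 \<noteq> 0"
    and "spectral_radius (complex_mat (companion r)) < 1"
    and "(\<forall>i. r $ i \<in> \<rat>)
       \<or> (\<exists>\<beta> p. pisot \<beta> \<and> is_min_poly p \<beta> \<and>
            map_poly of_rat p =
              [:- \<beta>, 1:] * (monom 1 CARD('n) + (\<Sum>k<CARD('n). monom (r $ ix k) k)))
       \<or> alg_independent_over_rat (\<lambda>i. r $ i)"
  shows "(\<exists>m>0. weak_m_tiling m (srs_tile r)) \<and>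
         (finiteness_property r \<longrightarrow> weak_tiling (srs_tile r))"
proof -
  obtain C \<rho> where C: "0 < C" "0 < \<rho>" "\<rho> < 1"
      "\<And>k v. norm (((*v) (companion r) ^^ k) v) \<le> C * \<rho> ^ k * norm v"
    using funpow_matrix_bound[OF assms(2)] by blast
  interpret contracting_srs r C \<rho>
    using assms(1) companion_abs_first_less_1[OF assms(2)] C by unfold_locales auto
  \<comment> \<open>The arithmetic hypotheses enter only here. The split is on rationality because
    the Pisot case needs an irrational coordinate.\<close>
  have small: "small_fracs_dense n \<delta>" if "\<delta> > 0" for n \<delta>
  proof (cases "\<forall>i. r $ i \<in> \<rat>")
    case True
    thus ?thesis using that by (rule small_fracs_dense_rational)
  next
    case False
    then obtain i where i: "r $ i \<notin> \<rat>" by blast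
    from assms(3) False consider
      (pisot) \<beta> p where "pisot \<beta>" "is_min_poly p \<beta>" "map_poly of_rat p =
              [:- \<beta>, 1:] * (monom 1 CARD('n) + (\<Sum>k<CARD('n). monom (r $ ix k) k))"
      | (independent) "alg_independent_over_rat (\<lambda>i. r $ i)" by blast
    thus ?thesis
    proof cases
      case pisot
      from min_poly_algebraic_int[OF _ pisot(2)] pisot(1) obtain P where "p = of_int_poly P"
        by (auto simp: pisot_def)
      from small_fracs_dense_expanding[OF _ pisot_step[OF pisot(3) this] i that] pisot(1)
      show ?thesis by (simp add: pisot_def)
    next
      case independent
      show ?thesis
        using alg_independent_imp_independent[OF independent] that
        by (intro small_fracs_dense_independent) blast+
    qed
  qed
  have "covering_degree T > 0"
    using ex_covering_degree covering_degree_at_pos by metis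
  moreover note weak_m_tiling_tiles[OF small]
  ultimately show ?thesis
    using covering_degree_eq_1 unfolding weak_tiling_def by auto
qed

end
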